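(* Let $n\ge1$. The map $\omega\circ\psi\colon V_n\to V_n$ is an involution, and for every $\pi\in V_n$ one has $s_{\omega(\psi(\pi))}=a_\pi$ and $a_{\omega(\psi(\pi))}=s_\pi$.
   Context: Let $[\pm n]=\{\pm1,\ldots,\pm n\}$. A partition of type $B_n$ is a set partition of $[\pm n]$ such that for every block $B$, $-B=\{-b:b\in B\}$ is a block, with at most one block satisfying $B=-B$ (the zero-block); $V_n$ is the set of such partitions without zero-block. More generally, let $S=\{\pm t_1,\ldots,\pm t_r\}$ with $0<t_1<\cdots<t_r$; a symmetric partition of $S$ is a partition of $S$ such that $-B$ is a block whenever $B$ is (the empty partition of $S=\emptyset$ is allowed). For such $\pi$: $\pm t_i$ is a singleton pair if $\{t_i\}$ is a block; $\pm(t_j,t_{j+1})$ is an adjacency pair if $t_j,t_{j+1}$ lie in the same block, indices taken cyclically ($t_{r+1}=t_1$); in that case $\pm t_j$ is called a left-point-pair. (If $r=1$, $\{\{t_1\},\{-t_1\}\}$ has one singleton pair and one adjacency pair $\pm(t_1,t_1)$, so $\pm t_1$ is also a left-point-pair.) For $\pi\in V_n$ (i.e. $S=[\pm n]$, $t_i=i$), $s_\pi$ and $a_\pi$ are its numbers of singleton pairs and adjacency pairs. Peeling. Given $\pi\in V_n$, set $\pi_0=\pi$. For $i\ge1$, as long as $\pi_{i-1}$ has a singleton pair or an adjacency pair, let $S_i$ be the set of elements $\pm t$ forming singleton pairs of $\pi_{i-1}$, $L_i$ the set of elements $\pm t$ forming left-point-pairs of $\pi_{i-1}$, and let $\pi_i$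 be the symmetric partition obtained from $\pi_{i-1}$ by deleting all elements of $S_i\cup L_i$ (and discarding empty blocks). Stop at the first $k$ such that $\pi_k$ has neither singleton pairs nor adjacency pairs ($\pi_k$ may be empty). Patching. Set $\sigma_k=\pi_k$. For $i=k,k-1,\ldots,1$, construct a symmetric partition $\sigma_{i-1}$ of the underlying set $\{\pm t_1,\ldots,\pm t_r\}$ ($0<t_1<\cdots<t_r$) of $\pi_{i-1}$ as follows. If $\sigma_i$ is empty: if $\pi_{i-1}$ consists of a single pair of blocks $\pm B$, let $\sigma_{i-1}=\{\pm\{t_1\},\ldots,\pm\{t_r\}\}$; otherwise let $\sigma_{i-1}=\{\pm\{t_1,\ldots,t_r\}\}$. If $\sigma_i$ is nonempty: decompose the positive elements of $S_i$ into maximal runs of cyclically consecutive elements $\{t_{j+1},t_{j+2},\ldots,t_{j+h}\}$ (indices mod $r$) of the list $t_1,\ldots,t_r$; for each run, $t_j$ is an element of $\sigma_i$, and one adds $t_{j+1},\ldots,t_{j+h}$ to the block of $\sigma_i$ containing $t_j$ and $-t_{j+1},\ldots,-t_{j+h}$ to the block containing $-t_j$; finally, for each positive $t$ with $\pm t\in L_i$, add the blocks $\{t\}$ and $\{-t\}$. The result is $\sigma_{i-1}$. Define $\psi(\pi)=\sigma_0$. Complement. For $i\in[n]$ define $\omega(i)=n+1-i$ and $\omega(-i)=-(n+1-i)$; for $\pi\in V_n$, $\omega(\pi)$ is the partition obtained by applying $\omega$ to every element of every block. *)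

theory Defs
  imports Main "HOL-Library.Disjoint_Sets"
begin

definition pm_interval :: "nat \<Rightarrow> int set" where
  "pm_interval n = {1..int n} \<union> uminus ` {1..int n}"

definition symmetric_partition :: "int set \<Rightarrow> int set set \<Rightarrow> bool" where
  "symmetric_partition S P \<longleftrightarrow> partition_on S P \<and> (\<forall>B\<in>P. uminus ` B \<in> P)"

definition zero_block :: "int set set \<Rightarrow> int set \<Rightarrow> bool" where
  "zero_block P B \<longleftrightarrow> B \<in> P \<and> uminus ` B = B"

definition type_B_partition :: "nat \<Rightarrow> int set set \<Rightarrow> bool" where
  "type_B_partition n P \<longleftrightarrow> symmetric_partition (pm_interval n) P \<and>
     (\<forall>B C. zero_block P B \<longrightarrow> zero_block P C \<longrightarrow> B = C)"

definition V :: "nat \<Rightarrow> int set set set" where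
  "V n = {P. type_B_partition n P \<and> \<not> (\<exists>B. zero_block P B)}"

definition positives :: "int set set \<Rightarrow> int set" where
  "positives P = {t \<in> \<Union>P. 0 < t}"

text \<open>
  For positive elements \<open>t\<^sub>1 < \<dots> < t\<^sub>r\<close>, indices are shifted to start from 0 and
  read cyclically: \<open>pt P 0 = t\<^sub>1\<close>, \<dots>, \<open>pt P (r - 1) = t\<^sub>r\<close>, \<open>pt P r = t\<^sub>1\<close>.
\<close>

definition pt :: "int set set \<Rightarrow> nat \<Rightarrow> int" where
  "pt P j = sorted_list_of_set (positives P) ! (j mod card (positives P))"

text \<open>
  A pair of the form \<open>\<plusminus>t\<close> is represented by its positive member, and an
  adjacency pair \<open>\<plusminus>(t, u)\<close> by the ordered pair \<open>(t, u)\<close> of positive numbers.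
  In particular, if \<open>r = 2\<close> and both positive elements lie in one block, then
  there are two adjacency pairs.
\<close>

definition singleton_pairs :: "int set set \<Rightarrow> int set" where
  "singleton_pairs P = {t. 0 < t \<and> {t} \<in> P}"

definition adjacency_pairs :: "int set set \<Rightarrow> (int \<times> int) set" where
  "adjacency_pairs P =
     {(pt P j, pt P (Suc j)) | j. j < card (positives P) \<and>
        (\<exists>B\<in>P. pt P j \<in> B \<and> pt P (Suc j) \<in> B)}"

definition left_point_pairs :: "int set set \<Rightarrow> int set" where
  "left_point_pairs P = fst ` adjacency_pairs P"

definition num_singleton_pairs :: "int set set \<Rightarrow> nat" where
  "num_singleton_pairs P = card (singleton_pairs P)"

definition num_adjacency_pairs :: "int set set \<Rightarrow> nat" where
  "num_adjacency_pairs P = card (adjacency_pairs P)"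

definition peel :: "int set set \<Rightarrow> int set set" where
  "peel P = (\<lambda>B. B - {x. \<bar>x\<bar> \<in> singleton_pairs P \<union> left_point_pairs P}) ` P - {{}}"

definition peeled :: "int set set \<Rightarrow> nat \<Rightarrow> int set set" where
  "peeled P i = (peel ^^ i) P"

text \<open>
  The least index exists for finite partitions, since every peeling step applied
  to a partition with a singleton pair or an adjacency pair deletes an element.
\<close>

definition peel_length :: "int set set \<Rightarrow> nat" where
  "peel_length P = (LEAST k. singleton_pairs (peeled P k) = {} \<and> adjacency_pairs (peeled P k) = {})"

text \<open>
  \<open>singleton_run Q j h\<close>: the elements \<open>pt Q (j + 1), \<dots>, pt Q (j + h)\<close> form a maximal
  run of cyclically consecutive singletons, and \<open>pt Q j\<close> is the non-singleton
  preceding it. Since \<open>pt Q (j + r) = pt Q j\<close>, such a run has fewer than \<open>r\<close> elements.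
\<close>

definition singleton_run :: "int set set \<Rightarrow> nat \<Rightarrow> nat \<Rightarrow> bool" where
  "singleton_run Q j h \<longleftrightarrow> j < card (positives Q) \<and> 1 \<le> h \<and>
     pt Q j \<notin> singleton_pairs Q \<and>
     (\<forall>m\<in>{1..h}. pt Q (j + m) \<in> singleton_pairs Q) \<and>
     pt Q (j + h + 1) \<notin> singleton_pairs Q"

definition enlarge_block :: "int set set \<Rightarrow> int set \<Rightarrow> int set" where
  "enlarge_block Q B = B
     \<union> {pt Q (j + m) | j h m. singleton_run Q j h \<and> pt Q j \<in> B \<and> m \<in> {1..h}}
     \<union> {- pt Q (j + m) | j h m. singleton_run Q j h \<and> - pt Q j \<in> B \<and> m \<in> {1..h}}"

text \<open>
  One patching step: \<open>Q\<close> is the peeled partition \<open>\<pi>\<close> with index \<open>i - 1\<close>, \<open>R\<close> is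
  the patched partition \<open>\<sigma>\<close> with index \<open>i\<close>, and the result is \<open>\<sigma>\<close> with index \<open>i - 1\<close>.
\<close>

definition patch :: "int set set \<Rightarrow> int set set \<Rightarrow> int set set" where
  "patch Q R =
     (if R = {} then
        (if \<exists>B. Q = {B, uminus ` B}
         then (\<Union>t\<in>positives Q. {{t}, {- t}})
         else {positives Q, uminus ` positives Q})
      else enlarge_block Q ` R \<union> (\<Union>t\<in>left_point_pairs Q. {{t}, {- t}}))"

definition psi :: "int set set \<Rightarrow> int set set" where
  "psi P = foldr patch (map (peeled P) [0..<peel_length P]) (peeled P (peel_length P))"

definition omega :: "nat \<Rightarrow> int \<Rightarrow> int" where
  "omega n x = (if 0 < x then int n + 1 - x else - (int n + 1 - (- x)))"

definition omega_partition :: "nat \<Rightarrow> int set set \<Rightarrow> int set set" where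
  "omega_partition n P = (\<lambda>B. omega n ` B) ` P"

end

theory Submission
  imports Defs
begin

text \<open>
  Represent the cyclic order of the positive elements by a list \<open>xs\<close>, so that reversing the list
  turns left points into right points (elements in the block of their cyclic predecessor). The key
  claim is that \<open>\<sigma> = \<psi>(\<pi>)\<close> has the left points of \<open>\<pi>\<close> as singletons and the singletons of
  \<open>\<pi>\<close> as right points. Hence peeling \<open>\<sigma>\<close> in the reversed order deletes the same elements as
  peeling \<open>\<pi>\<close> in the given one, and patching in the reversed
  order restores \<open>\<pi>\<close>, because a deleted left point lies in the block of the next surviving
  element. So \<open>\<psi>\<close> for the reversed order inverts \<open>\<psi>\<close>, and \<open>\<omega>\<close> intertwines the two orders.
\<close>

subsection \<open>Cyclic orders\<close>

text \<open>The key claim is not visible in a single patching step: a partition \<open>R\<close> of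
  the survivors has singletons and right points of its own, and these must disappear when the
  deleted elements return. The induction hypothesis for \<open>R\<close> makes them disappear. A
  singleton of \<open>R\<close> is a left point among the survivors that was not one before the
  deletion, so a deleted singleton sat right behind it, and patching puts that singleton into its
  block. Dually, a right point of \<open>R\<close> is a singleton of the peeled partition that was
  not one before, so a deleted left point sat right in front of it, and patching makes that element
  a separate block. The two swap equations determine the partner. Existence is therefore proved with
  a convenient preimage construction, and \<open>patch\<close> is compared only with an arbitrary
  partner satisfying the equations. The exceptional case is total deletion: no survivor is left to
  walk to, and with one positive element a singleton is also a left point. It accounts for the
  special branch of \<open>patch\<close>.\<close>

text \<open>
  \<open>cyclic_next xs\<close> is the cyclic successor in \<open>xs\<close>; the cyclic predecessor is
  \<open>cyclic_next (rev xs)\<close>.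
  \<open>first_from p xs v\<close> is the first element satisfying \<open>p\<close>, walking cyclically from \<open>v\<close> onwards.
\<close>

definition cyclic_next :: "'a list \<Rightarrow> 'a \<Rightarrow> 'a" where
  "cyclic_next xs t = hd (tl (dropWhile (\<lambda>x. x \<noteq> t) xs) @ xs)"

definition first_from :: "('a \<Rightarrow> bool) \<Rightarrow> 'a list \<Rightarrow> 'a \<Rightarrow> 'a" where
  "first_from p xs v = hd (filter p (dropWhile (\<lambda>x. x \<noteq> v) xs @ xs))"

lemma dropWhile_split: "v \<notin> set us \<Longrightarrow> dropWhile (\<lambda>x. x \<noteq> v) (us @ v # vs) = v # vs"
  by (induction us) auto

lemma cyclic_next_split:
  assumes "t \<notin> set us"
  shows "cyclic_next (us @ t # vs) t = hd (vs @ us @ [t])"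
  unfolding cyclic_next_def dropWhile_split[OF assms] by (cases us) (simp_all add: hd_append)

lemma cyclic_next_in: "t \<in> set xs \<Longrightarrow> cyclic_next xs t \<in> set xs"
proof -
  assume "t \<in> set xs"
  then obtain us vs where xs: "xs = us @ t # vs" "t \<notin> set us"
    by (metis split_list_first)
  have "hd (vs @ us @ [t]) \<in> set (vs @ us @ [t])" by (rule hd_in_set) simp
  then show ?thesis using xs by (auto simp: cyclic_next_split)
qed

lemma cyclic_next_rev_cyclic_next:
  assumes "distinct xs" "t \<in> set xs"
  shows "cyclic_next (rev xs) (cyclic_next xs t) = t"
proof -
  obtain us vs where xs: "xs = us @ t # vs" "t \<notin> set us" "t \<notin> set vs"
    using assms by (metis distinct.simps(2) distinct_append split_list_first)
  show ?thesis
  proof (cases vs)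
    case (Cons w ws)
    have "cyclic_next xs t = w" using xs Cons by (simp add: cyclic_next_split)
    moreover have "rev xs = rev ws @ w # (t # rev us)" using xs Cons by simp
    ultimately show ?thesis
      using assms(1) xs(1) Cons cyclic_next_split[of w "rev ws" "t # rev us"] by simp
  next
    case Nil
    show ?thesis
    proof (cases us)
      case Nil
      then show ?thesis using xs \<open>vs = []\<close> by (simp add: cyclic_next_def)
    next
      case (Cons w ws)
      have "cyclic_next xs t = w" using xs Cons Nil cyclic_next_split[of t us vs] by simp
      moreover have "rev xs = (t # rev ws) @ w # []" using xs Cons Nil by simp
      ultimately show ?thesis
        using assms(1) xs(1) Cons cyclic_next_split[of w "t # rev ws" "[]"] by auto
    qed
  qed
qed

lemma cyclic_next_cyclic_next_rev: "\<lbrakk>distinct xs; t \<in> set xs\<rbrakk>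
  \<Longrightarrow> cyclic_next xs (cyclic_next (rev xs) t) = t"
  using cyclic_next_rev_cyclic_next[of "rev xs" t] by simp

text \<open>Isolates the case of one positive element, the only one in which a singleton can also be
  a left point.\<close>

lemma cyclic_next_eq_self:
  assumes "distinct xs" "t \<in> set xs" "cyclic_next xs t = t"
  shows "set xs = {t}"
proof -
  obtain us vs where xs: "xs = us @ t # vs" "t \<notin> set us" "t \<notin> set vs"
    using assms by (metis distinct.simps(2) distinct_append split_list_first)
  then have "hd (vs @ us @ [t]) = t" using assms(3) by (simp add: cyclic_next_split)
  then show ?thesis using xs by (cases vs; cases us) auto
qed

lemma cyclic_next_nth:
  assumes "distinct xs" "j < length xs"
  shows "cyclic_next xs (xs ! j) = xs ! (Suc j mod length xs)"
proof -
  have xs: "xs = take j xs @ xs ! j # drop (Suc j) xs"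
    using assms id_take_nth_drop by blast
  have "xs ! j \<notin> set (take j xs)"
    using assms xs by (metis disjoint_iff distinct_append list.set_intros(1))
  then have "cyclic_next xs (xs ! j) = hd (drop (Suc j) xs @ take j xs @ [xs ! j])"
    using cyclic_next_split xs by metis
  also have "\<dots> = xs ! (Suc j mod length xs)"
  proof (cases "Suc j < length xs")
    case True
    then show ?thesis by (simp add: hd_append hd_drop_conv_nth)
  next
    case False
    then have "Suc j = length xs" using assms by simp
    then show ?thesis by (cases j) (auto simp: hd_append hd_conv_nth)
  qed
  finally show ?thesis .
qed

text \<open>Propagation against the cyclic order: from \<open>t\<close> down to index 0, through the
  wrap-around to the last index, and down again to \<open>u\<close>.\<close>

lemma cyclic_induct [consumes 3, case_names base step]:
  assumes "distinct xs" "u \<in> set xs" "t \<in> set xs"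
    and base: "Q t"
    and step: "\<And>v. \<lbrakk>v \<in> set xs; Q (cyclic_next xs v)\<rbrakk> \<Longrightarrow> Q v"
  shows "Q u"
proof -
  let ?r = "length xs"
  have down: "Q (xs ! j)" if "j \<le> i" "i < ?r" "Q (xs ! i)" for i j
    using that(1)
  proof (induction rule: inc_induct)
    case base
    then show ?case using that by simp
  next
    case (step m)
    then have "Suc m mod ?r = Suc m" using that by simp
    then show ?case using step that cyclic_next_nth[of xs m] assms(1) assms(5)[of "xs ! m"]
      by auto
  qed
  obtain i where i: "i < ?r" "xs ! i = t" using assms(3) by (meson in_set_conv_nth)
  obtain j where j: "j < ?r" "xs ! j = u" using assms(2) by (meson in_set_conv_nth)
  have "Q (xs ! 0)" using down[of 0 i] i base by simp
  moreover have "Suc (?r - 1) mod ?r = 0" using i by (cases ?r) auto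
  ultimately have "Q (xs ! (?r - 1))"
    using cyclic_next_nth[of xs "?r - 1"] assms(1) i step[of "xs ! (?r - 1)"] by auto
  then show ?thesis using down[of j "?r - 1"] j by simp
qed

lemma first_from_self: "\<lbrakk>v \<in> set xs; p v\<rbrakk> \<Longrightarrow> first_from p xs v = v"
  using split_list_first[of v xs] by (auto simp: first_from_def dropWhile_split)

text \<open>Both sides are the head of \<open>filter p (vs @ xs)\<close>, where \<open>vs\<close> is
  the part of \<open>xs\<close> after \<open>v\<close>. This recurrence carries every later walk
  along the cycle.\<close>

lemma first_from_cyclic_next:
  assumes "distinct xs" "v \<in> set xs" "filter p xs \<noteq> []"
  shows "first_from p xs (cyclic_next xs v)
    = (if p v then cyclic_next (filter p xs) v else first_from p xs v)"
proof -
  obtain us vs where xs: "xs = us @ v # vs" "v \<notin> set us" "v \<notin> set vs"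
    using assms by (metis distinct.simps(2) distinct_append split_list_first)
  have dW: "dropWhile (\<lambda>x. x \<noteq> v) xs = v # vs" using xs dropWhile_split by fast
  have lhs: "first_from p xs (cyclic_next xs v) = hd (filter p (vs @ xs))"
  proof (cases vs)
    case (Cons w ws)
    have "cyclic_next xs v = w" using xs Cons by (simp add: cyclic_next_split)
    moreover have "xs = (us @ [v]) @ w # ws" using xs Cons by simp
    moreover have "w \<notin> set (us @ [v])" using assms(1) xs Cons by auto
    ultimately show ?thesis
      using dropWhile_split[of w "us @ [v]" ws] Cons by (simp add: first_from_def)
  next
    case Nil
    then have "cyclic_next xs v = hd xs" using dW by (simp add: cyclic_next_def)
    then have "dropWhile (\<lambda>x. x \<noteq> cyclic_next xs v) xs = xs" by (cases xs) auto
    \<comment> \<open>The left side filters \<open>xs @ xs\<close> and the right side only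
      \<open>xs\<close>; the heads agree because \<open>xs\<close> already contains an element
      satisfying \<open>p\<close>.\<close>
    then show ?thesis using Nil assms(3) by (simp add: first_from_def hd_append)
  qed
  show ?thesis
  proof (cases "p v")
    case True
    have "filter p xs = filter p us @ v # filter p vs" using xs True by simp
    moreover have "v \<notin> set (filter p us)" using xs by simp
    ultimately have "dropWhile (\<lambda>x. x \<noteq> v) (filter p xs) = v # filter p vs"
      using dropWhile_split by metis
    then show ?thesis using True lhs by (simp add: cyclic_next_def)
  next
    case False
    then show ?thesis using lhs dW by (simp add: first_from_def)
  qed
qed

lemma first_from_in:
  assumes "distinct xs" "v \<in> set xs" "filter p xs \<noteq> []"
  shows "first_from p xs v \<in> set xs \<and> p (first_from p xs v)"
proof -
  have "filter p (dropWhile (\<lambda>x. x \<noteq> v) xs @ xs) \<noteq> []" using assms(3) by simp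
  then have "first_from p xs v \<in> set (filter p (dropWhile (\<lambda>x. x \<noteq> v) xs @ xs))"
    unfolding first_from_def by (rule hd_in_set)
  then show ?thesis by (auto dest: set_dropWhileD)
qed

lemma cyclic_next_map:
  assumes "inj_on g (set xs)" "t \<in> set xs"
  shows "cyclic_next (map g xs) (g t) = g (cyclic_next xs t)"
proof -
  obtain us vs where xs: "xs = us @ t # vs" "t \<notin> set us"
    using assms by (metis split_list_first)
  then have "g t \<notin> set (map g us)" using assms by (auto simp: inj_on_def)
  then show ?thesis using xs cyclic_next_split[of "g t" "map g us" "map g vs"]
    by (auto simp: cyclic_next_split hd_append hd_map)
qed

subsection \<open>Symmetric partitions without zero-block\<close>

definition plus_minus :: "int set \<Rightarrow> int set" where
  "plus_minus T = T \<union> uminus ` T"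

text \<open>The carrier is recorded by its positive half \<open>T\<close>, the half that the cyclic
  order lists.\<close>

definition zero_free :: "int set \<Rightarrow> int set set \<Rightarrow> bool" where
  "zero_free T P \<longleftrightarrow> symmetric_partition (plus_minus T) P \<and> (\<forall>B\<in>P. uminus ` B \<noteq> B) \<and> (\<forall>t\<in>T. 0 < t)"

definition same_block :: "int set set \<Rightarrow> int \<Rightarrow> int \<Rightarrow> bool" where
  "same_block P x y \<longleftrightarrow> (\<exists>B\<in>P. x \<in> B \<and> y \<in> B)"

definition left_points :: "int list \<Rightarrow> int set set \<Rightarrow> int set" where
  "left_points xs P = {t \<in> set xs. same_block P t (cyclic_next xs t)}"

definition restrict_blocks :: "int set set \<Rightarrow> int set \<Rightarrow> int set set" where
  "restrict_blocks P T = (\<lambda>B. B \<inter> plus_minus T) ` P - {{}}"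

lemma plus_minus_uminus [simp]: "- x \<in> plus_minus T \<longleftrightarrow> x \<in> plus_minus T"
  by (force simp: plus_minus_def)

lemma uminus_image_iff [simp]: "(x::int) \<in> uminus ` B \<longleftrightarrow> - x \<in> B"
  by force

lemma plus_minus_mono: "T \<subseteq> U \<Longrightarrow> plus_minus T \<subseteq> plus_minus U"
  by (auto simp: plus_minus_def)

lemma plus_minus_pos: "\<lbrakk>\<forall>t\<in>T. 0 < t; 0 < x\<rbrakk> \<Longrightarrow> x \<in> plus_minus T \<longleftrightarrow> x \<in> T"
  by (force simp: plus_minus_def)

lemma plus_minus_cases:
  assumes "x \<in> plus_minus T"
  obtains "x \<in> T" | "- x \<in> T"
  using assms by (auto simp: plus_minus_def)

text \<open>The last clause is the absence of zero-blocks in pointwise form: a block meeting its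
  negative equals it. In this form the condition passes easily to restrictions, relabellings and
  glued partitions.\<close>

lemma zero_freeD:
  assumes "zero_free T P"
  shows "\<Union>P = plus_minus T" "\<And>B C x. \<lbrakk>B \<in> P; C \<in> P; x \<in> B; x \<in> C\<rbrakk> \<Longrightarrow> B = C"
    "{} \<notin> P" "\<And>B. B \<in> P \<Longrightarrow> uminus ` B \<in> P" "\<And>t. t \<in> T \<Longrightarrow> 0 < t"
    "\<And>B x. \<lbrakk>B \<in> P; x \<in> B; - x \<in> B\<rbrakk> \<Longrightarrow> False"
proof -
  show 1: "\<Union>P = plus_minus T" "{} \<notin> P" "\<And>B. B \<in> P \<Longrightarrow> uminus ` B \<in> P" "\<And>t. t \<in> T \<Longrightarrow> 0 < t"
    using assms by (auto simp: zero_free_def symmetric_partition_def partition_on_def)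
  show 2: "B = C" if "B \<in> P" "C \<in> P" "x \<in> B" "x \<in> C" for B C x
    using assms that by
      (auto simp: zero_free_def symmetric_partition_def partition_on_def disjoint_def)
  show False if "B \<in> P" "x \<in> B" "- x \<in> B" for B x
  proof -
    have "x \<in> uminus ` B" using that(3) by force
    then have "B = uminus ` B" using 2[OF that(1) 1(3)[OF that(1)] that(2)] by blast
    then show False using assms that(1) unfolding zero_free_def by metis
  qed
qed

lemma zero_freeI:
  assumes "\<Union>P = plus_minus T" "\<And>B C x. \<lbrakk>B \<in> P; C \<in> P; x \<in> B; x \<in> C\<rbrakk> \<Longrightarrow> B = C"
    "{} \<notin> P" "\<And>B. B \<in> P \<Longrightarrow> uminus ` B \<in> P" "\<And>t. t \<in> T \<Longrightarrow> 0 < t"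
    "\<And>B x. \<lbrakk>B \<in> P; x \<in> B; - x \<in> B\<rbrakk> \<Longrightarrow> False"
  shows "zero_free T P"
  unfolding zero_free_def symmetric_partition_def partition_on_def disjoint_def
proof (intro conjI ballI impI)
  show "B \<inter> C = {}" if "B \<in> P" "C \<in> P" "B \<noteq> C" for B C
    using assms(2)[OF that(1,2)] that(3) by auto
  show "uminus ` B \<noteq> B" if B: "B \<in> P" for B
  proof
    assume eq: "uminus ` B = B"
    obtain x where "x \<in> B" using assms(3) B by (metis ex_in_conv)
    moreover have "- x \<in> uminus ` B" using calculation by blast
    ultimately show False using assms(6)[OF B] eq by blast
  qed
qed (fact assms)+

lemma same_block_sym: "same_block P x y \<Longrightarrow> same_block P y x"
  by (auto simp: same_block_def)

lemma same_block_trans: "\<lbrakk>zero_free T P; same_block P x y; same_block P y z\<rbrakk> \<Longrightarrow> same_block P x z"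
  unfolding same_block_def using zero_freeD(2)[of T P _ _ y] by blast

lemma same_block_refl: "\<lbrakk>zero_free T P; x \<in> plus_minus T\<rbrakk> \<Longrightarrow> same_block P x x"
  using zero_freeD(1)[of T P] by (auto simp: same_block_def)

lemma same_block_singleton: "\<lbrakk>zero_free T P; {x} \<in> P; same_block P x y\<rbrakk> \<Longrightarrow> y = x"
  unfolding same_block_def using zero_freeD(2)[of T P _ "{x}" x] by blast

lemma same_block_in_block: "\<lbrakk>zero_free T P; B \<in> P; x \<in> B; same_block P x y\<rbrakk> \<Longrightarrow> y \<in> B"
  unfolding same_block_def using zero_freeD(2)[of T P _ B x] by blast

lemma singleton_iff: "t \<in> singleton_pairs P \<longleftrightarrow> 0 < t \<and> {t} \<in> P"
  by (simp add: singleton_pairs_def)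

lemma singleton_pairs_subset:
  assumes g: "zero_free T P"
  shows "singleton_pairs P \<subseteq> T"
proof
  fix t assume t: "t \<in> singleton_pairs P"
  then have "t \<in> \<Union>P" by (auto simp: singleton_iff)
  then show "t \<in> T" using t zero_freeD(1)[OF g] zero_freeD(5)[OF g] plus_minus_pos
    by (simp add: singleton_iff)
qed

lemma positives_zero_free: "zero_free T P \<Longrightarrow> positives P = T"
  unfolding positives_def zero_freeD(1) using zero_freeD(5)[of T P] plus_minus_pos[of T] by auto

lemma zero_free_empty_iff:
  assumes g: "zero_free T P"
  shows "P = {} \<longleftrightarrow> T = {}"
proof
  show "T = {}" if "P = {}" using zero_freeD(1)[OF g] that by (simp add: plus_minus_def)
  show "P = {}" if "T = {}"
  proof -
    have "\<Union>P = {}" using zero_freeD(1)[OF g] that by (simp add: plus_minus_def)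
    then show ?thesis using zero_freeD(3)[OF g] by auto
  qed
qed

lemma zero_free_restrict_blocks:
  assumes g: "zero_free T P" and "U \<subseteq> T"
  shows "zero_free U (restrict_blocks P U)"
proof (rule zero_freeI)
  show "\<Union>(restrict_blocks P U) = plus_minus U"
  proof -
    have "\<Union>(restrict_blocks P U) = \<Union>P \<inter> plus_minus U" unfolding restrict_blocks_def by blast
    then show ?thesis using zero_freeD(1)[OF g] plus_minus_mono[OF assms(2)] by auto
  qed
  show "uminus ` B \<in> restrict_blocks P U" if "B \<in> restrict_blocks P U" for B
  proof -
    obtain C where C: "C \<in> P" "B = C \<inter> plus_minus U" "B \<noteq> {}" using \<open>B \<in> restrict_blocks P U\<close>
      by (auto simp: restrict_blocks_def)
    have "uminus ` B = (uminus ` C) \<inter> plus_minus U" using C by (auto simp: image_iff)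
    then show ?thesis using C zero_freeD(4)[OF g, of C] by (auto simp: restrict_blocks_def)
  qed
  show "B = C" if "B \<in> restrict_blocks P U" "C \<in> restrict_blocks P U" "x \<in> B" "x \<in> C" for B C x
    using that zero_freeD(2)[OF g] by (fastforce simp: restrict_blocks_def)
qed (use zero_freeD[OF g] assms in \<open>auto simp: restrict_blocks_def\<close>)

lemma same_block_restrict_blocks: "same_block (restrict_blocks P U) x y \<longleftrightarrow> same_block P x y
  \<and> x \<in> plus_minus U \<and> y \<in> plus_minus U"
  unfolding same_block_def restrict_blocks_def by blast

text \<open>
  \<open>psi_rel xs P Q\<close> expresses \<open>\<psi>(P) = Q\<close> relative to the cyclic order \<open>xs\<close> of the positive
  elements. Its second rule is symmetric under swapping \<open>P\<close> and \<open>Q\<close> and reversing \<open>xs\<close>.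
\<close>

inductive psi_rel :: "int list \<Rightarrow> int set set \<Rightarrow> int set set \<Rightarrow> bool" where
  stop: "\<lbrakk>distinct xs; zero_free (set xs) P; singleton_pairs P = {}; left_points xs P = {}\<rbrakk>
    \<Longrightarrow> psi_rel xs P P"
| step: "\<lbrakk>distinct xs; zero_free (set xs) P; zero_free (set xs) Q; singleton_pairs P
  = left_points (rev xs) Q;
          left_points xs P = singleton_pairs Q; singleton_pairs P \<union> singleton_pairs Q \<noteq> {};
          ys = filter (\<lambda>t. t \<notin> singleton_pairs P \<and> t \<notin> singleton_pairs Q) xs;
          psi_rel ys (restrict_blocks P (set ys)) (restrict_blocks Q (set ys))\<rbrakk> \<Longrightarrow> psi_rel xs P Q"

text \<open>The cyclic predecessor of a right point is a left point.\<close>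

lemma left_points_rev_empty:
  assumes "distinct xs" "left_points xs P = {}"
  shows "left_points (rev xs) P = {}"
proof (rule ccontr)
  assume "left_points (rev xs) P \<noteq> {}"
  then obtain t where t: "t \<in> set xs" "same_block P t (cyclic_next (rev xs) t)"
    by (auto simp: left_points_def)
  then have "cyclic_next (rev xs) t \<in> left_points xs P"
    using cyclic_next_in[of t "rev xs"] cyclic_next_cyclic_next_rev[OF assms(1)]
      by (auto simp: left_points_def same_block_sym)
  then show False using assms by simp
qed

lemma psi_rel_props:
  assumes "psi_rel xs P Q"
  shows "distinct xs" "zero_free (set xs) P" "zero_free (set xs) Q"
    "singleton_pairs P = left_points (rev xs) Q" "left_points xs P = singleton_pairs Q"
  using assms by (induction) (auto simp: left_points_rev_empty)

text \<open>This is the source of the involution, obtained before the relation is connected with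
  \<open>psi\<close>.\<close>

lemma psi_rel_rev: "psi_rel xs P Q \<Longrightarrow> psi_rel (rev xs) Q P"
proof (induction rule: psi_rel.induct)
  case (stop xs P)
  then show ?case by (simp add: psi_rel.stop left_points_rev_empty)
next
  case (step xs P Q ys)
  show ?case
  proof (rule psi_rel.step)
    show "rev ys = filter (\<lambda>t. t \<notin> singleton_pairs Q \<and> t \<notin> singleton_pairs P) (rev xs)"
      using step by (simp add: rev_filter conj_commute)
  qed (use step in auto)
qed

section \<open>Transport of the relation along odd relabellings\<close>

definition map_blocks :: "(int \<Rightarrow> int) \<Rightarrow> int set set \<Rightarrow> int set set" where
  "map_blocks g P = (\<lambda>B. g ` B) ` P"

text \<open>Order-reversing maps such as \<open>omega\<close> belong to this class: the cyclic order
  is carried by the list and moves along with \<open>map g\<close>.\<close>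

definition odd_inj :: "int set \<Rightarrow> (int \<Rightarrow> int) \<Rightarrow> bool" where
  "odd_inj T g \<longleftrightarrow> inj_on g (plus_minus T) \<and> (\<forall>x\<in>plus_minus T. g (- x) = - g x) \<and> (\<forall>t\<in>T. 0 < g t)"

lemma odd_inj_mono: "\<lbrakk>odd_inj T g; U \<subseteq> T\<rbrakk> \<Longrightarrow> odd_inj U g"
  using plus_minus_mono[of U T] by (auto simp: odd_inj_def inj_on_subset)

lemma plus_minus_image: "odd_inj T g \<Longrightarrow> U \<subseteq> T \<Longrightarrow> plus_minus (g ` U) = g ` plus_minus U"
proof -
  assume "odd_inj T g" "U \<subseteq> T"
  then have "\<forall>x\<in>U. g (- x) = - g x" by (auto simp: odd_inj_def plus_minus_def)
  then show ?thesis unfolding plus_minus_def image_Un image_image by simp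
qed

lemma block_sub: "\<lbrakk>zero_free T P; B \<in> P\<rbrakk> \<Longrightarrow> B \<subseteq> plus_minus T"
  using zero_freeD(1) by blast

lemma zero_free_map_blocks:
  assumes g: "zero_free T P" and o: "odd_inj T g"
  shows "zero_free (g ` T) (map_blocks g P)"
proof (rule zero_freeI)
  have inj: "inj_on g (plus_minus T)" and neg: "\<And>x. x \<in> plus_minus T \<Longrightarrow> g (- x) = - g x"
    using o by (auto simp: odd_inj_def)
  show "\<Union>(map_blocks g P) = plus_minus (g ` T)"
    using zero_freeD(1)[OF g] by (auto simp: map_blocks_def plus_minus_image[OF o])
  show "B = C" if BC: "B \<in> map_blocks g P" "C \<in> map_blocks g P" "x \<in> B" "x \<in> C" for B C x
  proof -
    obtain B' C' y z where "B' \<in> P" "C' \<in> P" "B = g ` B'" "C = g ` C'" "y \<in> B'" "z \<in> C'" "x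
      = g y" "x = g z"
      using BC unfolding map_blocks_def by blast
    moreover have "y = z" using calculation block_sub[OF g] inj by (metis inj_onD subsetD)
    ultimately show ?thesis using zero_freeD(2)[OF g] by metis
  qed
  show "{} \<notin> map_blocks g P" using zero_freeD(3)[OF g] by (auto simp: map_blocks_def)
  show "uminus ` B \<in> map_blocks g P" if B: "B \<in> map_blocks g P" for B
  proof -
    obtain B' where B': "B' \<in> P" "B = g ` B'" using B by (auto simp: map_blocks_def)
    have "uminus ` B = g ` (uminus ` B')"
      unfolding B' image_image using neg block_sub[OF g B'(1)] by (intro image_cong) auto
    then show ?thesis using zero_freeD(4)[OF g B'(1)] by (auto simp: map_blocks_def)
  qed
  show "0 < t" if "t \<in> g ` T" for t using that o by (auto simp: odd_inj_def)
  show False if BC: "B \<in> map_blocks g P" "x \<in> B" "- x \<in> B" for B x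
  proof -
    obtain B' y z where "B' \<in> P" "y \<in> B'" "z \<in> B'" "x = g y" "- x = g z"
      using BC unfolding map_blocks_def by blast
    moreover have "y \<in> plus_minus T" "z \<in> plus_minus T" using calculation block_sub[OF g] by auto
    moreover have "g z = g (- y)" using calculation neg by simp
    moreover have "z = - y" using calculation inj by (metis inj_onD plus_minus_uminus)
    ultimately show False using zero_freeD(6)[OF g] by metis
  qed
qed

lemma same_block_map_blocks:
  assumes g: "zero_free T P" and o: "odd_inj T g" and "x \<in> plus_minus T" "y \<in> plus_minus T"
  shows "same_block (map_blocks g P) (g x) (g y) \<longleftrightarrow> same_block P x y"
proof -
  have "g z \<in> g ` B \<longleftrightarrow> z \<in> B" if "B \<in> P" "z \<in> plus_minus T" for B z
    using that o block_sub[OF g that(1)] inj_on_image_mem_iff[of g "plus_minus T"]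
      by (auto simp: odd_inj_def)
  then show ?thesis using assms by (auto simp: same_block_def map_blocks_def)
qed

lemma singleton_pairs_map_blocks:
  assumes g: "zero_free T P" and o: "odd_inj T g"
  shows "singleton_pairs (map_blocks g P) = g ` singleton_pairs P"
proof (intro equalityI subsetI)
  fix t assume t: "t \<in> singleton_pairs (map_blocks g P)"
  then obtain B where B: "B \<in> P" "g ` B = {t}" "0 < t"
    by (auto simp: singleton_iff map_blocks_def)
  then obtain x where x: "x \<in> B" "g x = t" by blast
  have "B = {x}" using B x o block_sub[OF g] unfolding odd_inj_def inj_on_def by blast
  moreover have "x \<in> plus_minus T" using B x block_sub[OF g] by auto
  moreover have "x \<in> T"
  proof (rule ccontr)
    assume "x \<notin> T"
    then have m: "- x \<in> T" using \<open>x \<in> plus_minus T\<close> plus_minus_cases by blast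
    then have "0 < g (- x)" using o unfolding odd_inj_def by blast
    then show False using o x B(3) \<open>x \<in> plus_minus T\<close> unfolding odd_inj_def by force
  qed
  moreover have "0 < x" using zero_freeD(5)[OF g] calculation by blast
  ultimately show "t \<in> g ` singleton_pairs P" using x B by (auto simp: singleton_iff)
next
  fix t assume "t \<in> g ` singleton_pairs P"
  then obtain x where x: "x \<in> singleton_pairs P" "t = g x" by blast
  then have "x \<in> T" using singleton_pairs_subset[OF g] by blast
  then show "t \<in> singleton_pairs (map_blocks g P)"
    using x o by (force simp: singleton_iff map_blocks_def odd_inj_def)
qed

lemma left_points_map_blocks:
  assumes g: "zero_free (set xs) P" and o: "odd_inj (set xs) g"
  shows "left_points (map g xs) (map_blocks g P) = g ` left_points xs P"
proof -
  have inj: "inj_on g (set xs)" using o by (auto simp: odd_inj_def plus_minus_def inj_on_Un)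
  have "same_block (map_blocks g P) (g x) (cyclic_next (map g xs) (g x))
    \<longleftrightarrow> same_block P x (cyclic_next xs x)" if "x \<in> set xs" for x
    using same_block_map_blocks[OF g o, of x "cyclic_next xs x"] that cyclic_next_in[OF that]
      cyclic_next_map[OF inj that]
    by (auto simp: plus_minus_def)
  then show ?thesis by (auto simp: left_points_def)
qed

lemma restrict_blocks_map_blocks:
  assumes g: "zero_free T P" and o: "odd_inj T g" and "U \<subseteq> T"
  shows "restrict_blocks (map_blocks g P) (g ` U) = map_blocks g (restrict_blocks P U)"
proof -
  have "g ` B \<inter> plus_minus (g ` U) = g ` (B \<inter> plus_minus U)" if "B \<in> P" for B
    using inj_on_image_Int[of g "plus_minus T" B "plus_minus U"] o block_sub[OF g that]
      plus_minus_mono[OF assms(3)]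
    by (simp add: plus_minus_image[OF o assms(3)] odd_inj_def)
  then have "(\<lambda>B. B \<inter> plus_minus (g ` U)) ` map_blocks g P = (\<lambda>B. g ` (B \<inter> plus_minus U)) ` P"
    by (simp add: map_blocks_def image_image)
  moreover have "(\<lambda>B. g ` (B \<inter> plus_minus U)) ` P - {{}}
    = (\<lambda>B. g ` B) ` ((\<lambda>B. B \<inter> plus_minus U) ` P - {{}})"
    by blast
  ultimately show ?thesis by (simp add: restrict_blocks_def map_blocks_def)
qed

lemma psi_rel_map_blocks: "\<lbrakk>psi_rel xs P Q; odd_inj (set xs) g\<rbrakk>
  \<Longrightarrow> psi_rel (map g xs) (map_blocks g P) (map_blocks g Q)"
proof (induction rule: psi_rel.induct)
  case (stop xs P)
  have "inj_on g (set xs)" using stop by (auto simp: odd_inj_def plus_minus_def inj_on_Un)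
  then show ?case
    using stop zero_free_map_blocks[OF stop(2)] left_points_map_blocks[of xs P g]
      singleton_pairs_map_blocks[OF stop(2)]
    by (intro psi_rel.stop) (auto simp: distinct_map)
next
  case (step xs P Q ys)
  have inj: "inj_on g (set xs)" using step by (auto simp: odd_inj_def plus_minus_def inj_on_Un)
  have sub: "set ys \<subseteq> set xs" using step by auto
  note sP = singleton_pairs_map_blocks[OF step(2) step(10)]
    and sQ = singleton_pairs_map_blocks[OF step(3) step(10)]
  have o: "odd_inj (set (rev xs)) g" using step by simp
  show ?case
  proof (rule psi_rel.step)
    show "map g ys = filter (\<lambda>t. t \<notin> singleton_pairs (map_blocks g P)
      \<and> t \<notin> singleton_pairs (map_blocks g Q)) (map g xs)"
      unfolding sP sQ step(7) filter_map o_def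
      using inj singleton_pairs_subset[OF step(2)] singleton_pairs_subset[OF step(3)]
      by (intro arg_cong[of _ _ "map g"] filter_cong) (auto simp: inj_on_image_mem_iff)
    show "singleton_pairs (map_blocks g P) = left_points (rev (map g xs)) (map_blocks g Q)"
      using left_points_map_blocks[of "rev xs" Q g] step o sP by (simp add: rev_map)
    show "left_points (map g xs) (map_blocks g P) = singleton_pairs (map_blocks g Q)"
      using left_points_map_blocks[of xs P g] step sQ by simp
    show "psi_rel (map g ys) (restrict_blocks (map_blocks g P) (set (map g ys)))
      (restrict_blocks (map_blocks g Q) (set (map g ys)))"
      using step(9)[OF odd_inj_mono[OF step(10) sub]]
        restrict_blocks_map_blocks[OF step(2,10) sub]
        restrict_blocks_map_blocks[OF step(3,10) sub] by simp
  qed (use step inj zero_free_map_blocks sP sQ in \<open>auto simp: distinct_map\<close>)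
qed

subsection \<open>The patched partition\<close>

text \<open>The case in which a peeling step leaves something. A survivor gives every walk along the
  cycle a place to end, and it forces at least two positive elements as soon as one is
  deleted.\<close>

locale peeling =
  fixes xs :: "int list" and P :: "int set set"
  assumes dist: "distinct xs" and zero_free: "zero_free (set xs) P"
    and rest: "filter (\<lambda>t. t \<notin> singleton_pairs P \<and> t \<notin> left_points xs P) xs \<noteq> []"
begin

abbreviation "S \<equiv> singleton_pairs P"
abbreviation "L \<equiv> left_points xs P"
abbreviation "kept t \<equiv> t \<notin> S \<and> t \<notin> L"
abbreviation "ys \<equiv> filter kept xs"

lemma sub: "S \<subseteq> set xs" "L \<subseteq> set xs" "set ys \<subseteq> set xs"
  using singleton_pairs_subset[OF zero_free] by (auto simp: left_points_def)

lemma not_self: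
  assumes "t \<in> S \<union> L"
  shows "cyclic_next xs t \<noteq> t" "cyclic_next (rev xs) t \<noteq> t"
proof -
  have "set xs \<noteq> {t}" using rest assms by (auto simp: filter_empty_conv)
  moreover have "t \<in> set xs" using assms sub by auto
  ultimately show "cyclic_next xs t \<noteq> t" "cyclic_next (rev xs) t \<noteq> t"
    using cyclic_next_eq_self[OF dist] cyclic_next_eq_self[of "rev xs" t] dist by auto
qed

text \<open>A singleton shares a block only with itself, so as a left point it would be its own
  successor. The next lemma uses the same argument for the successor of a left point.\<close>

lemma S_L_disjoint: "t \<in> S \<Longrightarrow> t \<notin> L"
  using not_self same_block_singleton[OF zero_free, of t "cyclic_next xs t"]
    by (auto simp: singleton_iff left_points_def)

lemma cyclic_next_L: "t \<in> L \<Longrightarrow> cyclic_next xs t \<notin> S"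
  using not_self(1)[of t] same_block_singleton[OF zero_free, of "cyclic_next xs t" t]
    same_block_sym[of P t "cyclic_next xs t"]
  by (auto simp: singleton_iff left_points_def)

lemma prev_S: "t \<in> S \<Longrightarrow> cyclic_next (rev xs) t \<notin> L"
  using cyclic_next_L[of "cyclic_next (rev xs) t"] cyclic_next_cyclic_next_rev[OF dist, of t] sub
    by auto

lemma zero_free_rest: "zero_free (set ys) (restrict_blocks P (set ys))"
  using zero_free_restrict_blocks[OF zero_free sub(3)] .

lemma in_plus_minus: "t \<in> set xs \<Longrightarrow> t \<in> plus_minus (set xs)"
  by (simp add: plus_minus_def)

text \<open>Starting at a non-singleton, the walk to the first survivor passes only left points,
  because by \<open>cyclic_next_L\<close> no left point is followed by a singleton. Each of them
  hands its block on to its successor.\<close>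

lemma same_block_first_from: "\<lbrakk>v \<in> set xs; v \<notin> S\<rbrakk> \<Longrightarrow> same_block P v (first_from kept xs v)"
proof -
  assume v: "v \<in> set xs" "v \<notin> S"
  have t: "hd ys \<in> set xs" "kept (hd ys)" using hd_in_set[OF rest] by auto
  have "v \<notin> S \<longrightarrow> same_block P v (first_from kept xs v)"
    using dist v(1) t(1)
  proof (induction rule: cyclic_induct)
    case base
    then show ?case using first_from_self[OF t(1), of kept]
      t same_block_refl[OF zero_free in_plus_minus] by auto
  next
    case (step v)
    show ?case
    proof (cases "v \<in> L")
      case True
      then have "same_block P v (cyclic_next xs v)" by (simp add: left_points_def)
      moreover have "same_block P (cyclic_next xs v) (first_from kept xs v)"
        using step cyclic_next_L[OF True] True first_from_cyclic_next[OF dist step(1) rest]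
          by simp
      ultimately show ?thesis using same_block_trans[OF zero_free] by blast
    next
      case False
      then show ?thesis
        using step(1) first_from_self[OF step(1), of kept]
          same_block_refl[OF zero_free in_plus_minus] by auto
    qed
  qed
  then show ?thesis using v by simp
qed

text \<open>The walk consists of left points until it reaches \<open>t\<close>, so its last step
  enters \<open>t\<close> from a left point.\<close>

lemma first_from_reached: "\<lbrakk>v \<in> set xs; v \<notin> S; first_from kept xs v = t; v \<noteq> t\<rbrakk>
  \<Longrightarrow> cyclic_next (rev xs) t \<in> L"
proof -
  assume v: "v \<in> set xs" "v \<notin> S" "first_from kept xs v = t" "v \<noteq> t"
  have t: "hd ys \<in> set xs" "kept (hd ys)" using hd_in_set[OF rest] by auto
  have "v \<notin> S \<longrightarrow> first_from kept xs v = t \<longrightarrow> v \<noteq> t \<longrightarrow> cyclic_next (rev xs) t \<in> L"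
    using dist v(1) t(1)
  proof (induction rule: cyclic_induct)
    case base
    then show ?case using first_from_self[OF t(1), of kept] t by auto
  next
    case (step v)
    show ?case
    proof (cases "v \<in> L")
      case True
      then show ?thesis
        using step cyclic_next_L[OF True] first_from_cyclic_next[OF dist step(1) rest]
          cyclic_next_rev_cyclic_next[OF dist step(1)]
        by (cases "cyclic_next xs v = t") auto
    next
      case False
      then show ?thesis using first_from_self[OF step(1), of kept] by auto
    qed
  qed
  then show ?thesis using v by simp
qed

lemma first_from_kept: "v \<in> set xs \<Longrightarrow> first_from kept xs v \<in> set ys"
  using first_from_in[OF dist _ rest] by auto

text \<open>As \<open>t\<close> survived, its block in \<open>P\<close> had a second element
  \<open>x\<close>, which was deleted. No singleton, \<open>x\<close> is a left point, and its walk
  ends at the only survivor of its block, namely \<open>t\<close>; so the element before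
  \<open>t\<close> is a left point.\<close>

lemma new_singleton:
  assumes "t \<in> set ys" "{t} \<in> restrict_blocks P (set ys)"
  shows "cyclic_next (rev xs) t \<in> L"
proof -
  obtain B where B: "B \<in> P" "B \<inter> plus_minus (set ys) = {t}" using assms(2)
    by (auto simp: restrict_blocks_def)
  have tB: "t \<in> B" using B(2) by blast
  have tpos: "0 < t" using zero_freeD(5)[OF zero_free, of t] assms(1) by auto
  have "B \<noteq> {t}" using assms(1) B(1) tpos by (auto simp: singleton_iff)
  then obtain x where x: "x \<in> B" "x \<noteq> t" using tB by blast
  have xpm: "x \<in> plus_minus (set xs)" using block_sub[OF zero_free B(1)] x by auto
  have samex: "same_block P x t" using x B(1) tB by (auto simp: same_block_def)
  have key: "same_block P v (first_from kept xs v) \<and> first_from kept xs v \<in> set ys"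
    if "v \<in> set xs" "{v} \<notin> P" for v
    using same_block_first_from[of v] first_from_kept[of v] that by (auto simp: singleton_iff)
  from xpm show ?thesis
  proof (cases rule: plus_minus_cases)
    case 1
    have nS: "{x} \<notin> P" using same_block_singleton[OF zero_free _ samex] x by auto
    have "first_from kept xs x \<in> B" using key[OF 1 nS] same_block_in_block[OF zero_free B(1) x(1)]
      by blast
    then have "first_from kept xs x = t" using key[OF 1 nS] B(2) by (auto simp: plus_minus_def)
    then show ?thesis using first_from_reached[OF 1 _ _ x(2)] nS by (auto simp: singleton_iff)
  next
    case 2
    \<comment> \<open>A negative \<open>x\<close> is impossible: \<open>- x\<close> would walk to a
      positive survivor in the negative block, and the negative of that survivor would have to be
      the positive number \<open>t\<close>.\<close>
    let ?v = "- x"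
    have B': "uminus ` B \<in> P" using zero_freeD(4)[OF zero_free B(1)] .
    have "t \<noteq> x" using x by simp
    have nS: "{?v} \<notin> P"
    proof
      assume "{?v} \<in> P"
      then have "uminus ` {?v} \<in> P" by (rule zero_freeD(4)[OF zero_free])
      then show False using same_block_singleton[OF zero_free _ samex] x by auto
    qed
    have "first_from kept xs ?v \<in> uminus ` B"
      using key[OF 2 nS] same_block_in_block[OF zero_free B', of ?v] x by auto
    then have "- first_from kept xs ?v \<in> B \<inter> plus_minus (set ys)" using key[OF 2 nS]
      by (simp add: plus_minus_def)
    then have "- first_from kept xs ?v = t" unfolding B(2) by simp
    moreover have "0 < first_from kept xs ?v"
      using key[OF 2 nS] zero_freeD(5)[OF zero_free_rest] by blast
    ultimately show ?thesis using tpos by simp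
  qed
qed

text \<open>If no singleton followed \<open>t\<close>, the walk from its successor to the next
  survivor would stay in one block, so \<open>t\<close> would have been a left point of
  \<open>P\<close> already.\<close>

lemma kept_not_left:
  assumes "t \<in> set ys" "same_block P t (cyclic_next ys t)"
  shows "cyclic_next xs t \<in> S"
proof (rule ccontr)
  assume nS: "cyclic_next xs t \<notin> S"
  have t: "t \<in> set xs" "kept t" using assms(1) by auto
  have "same_block P (cyclic_next xs t) (first_from kept xs (cyclic_next xs t))"
    using same_block_first_from[OF cyclic_next_in[OF t(1)] nS] .
  also have "first_from kept xs (cyclic_next xs t) = cyclic_next ys t"
    using first_from_cyclic_next[OF dist t(1) rest] t by simp
  finally have "same_block P t (cyclic_next xs t)"
    using same_block_trans[OF zero_free assms(2)] same_block_sym by blast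
  then show False using t by (simp add: left_points_def)
qed

text \<open>
  One patching step as a preimage: \<open>base\<close> sends a singleton to the surviving element that its
  maximal run follows, so \<open>glue B\<close> is the block \<open>B\<close> of a partition of \<open>ys\<close> with these runs added.
\<close>

definition base :: "int \<Rightarrow> int" where
  "base x = (if 0 < x then first_from kept (rev xs) x else - first_from kept (rev xs) (- x))"

definition glue :: "int set \<Rightarrow> int set" where
  "glue B = {x \<in> plus_minus (set xs - L). base x \<in> B}"

definition glued :: "int set set \<Rightarrow> int set set" where
  "glued R = glue ` R \<union> (\<Union>t\<in>L. {{t}, {- t}})"

lemma rest_rev: "filter kept (rev xs) \<noteq> []"
  using rest by (simp add: rev_filter[symmetric])

lemma base_kept: "t \<in> set ys \<Longrightarrow> base t = t"
  using first_from_self[of t "rev xs" kept] zero_freeD(5)[OF zero_free, of t]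
    by (simp add: base_def)

lemma base_uminus: "x \<noteq> 0 \<Longrightarrow> base (- x) = - base x"
  by (simp add: base_def)

lemma plus_minus_nonzero: "x \<in> plus_minus (set xs) \<Longrightarrow> x \<noteq> 0"
  using zero_freeD(5)[OF zero_free] by (force simp: plus_minus_def)

text \<open>Compares the bases of cyclic neighbours; away from \<open>L\<close>, these decide
  whether the neighbours share a block of a glued partition.\<close>

lemma base_prev:
  assumes "t \<in> set xs"
  shows "base (cyclic_next (rev xs) t) = (if kept t then cyclic_next (rev ys) t else base t)"
proof -
  have "0 < t" "0 < cyclic_next (rev xs) t"
    using zero_freeD(5)[OF zero_free] assms cyclic_next_in[of t "rev xs"] by auto
  then show ?thesis using first_from_cyclic_next[of "rev xs" t kept] dist assms rest_rev
    by (simp add: base_def rev_filter)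
qed

lemma base_in: "x \<in> plus_minus (set xs) \<Longrightarrow> base x \<in> plus_minus (set ys)"
proof (erule plus_minus_cases)
  assume "x \<in> set xs"
  then show ?thesis using first_from_in[of "rev xs" x kept]
    dist rest_rev zero_freeD(5)[OF zero_free, of x]
    by (simp add: base_def plus_minus_def)
next
  assume "- x \<in> set xs"
  then show ?thesis using first_from_in[of "rev xs" "- x" kept]
    dist rest_rev zero_freeD(5)[OF zero_free, of "- x"]
    by (simp add: base_def plus_minus_def)
qed

lemma plus_minus_base: "x \<in> plus_minus (set ys) \<Longrightarrow> base x = x"
proof (erule plus_minus_cases)
  assume "- x \<in> set ys"
  then show ?thesis using base_kept[of "- x"] base_uminus[of x] plus_minus_nonzero[of x]
    plus_minus_def by auto
qed (rule base_kept)

lemma glue_inter: "B \<subseteq> plus_minus (set ys) \<Longrightarrow> glue B \<inter> plus_minus (set ys) = B"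
  using plus_minus_base plus_minus_mono[of "set ys" "set xs - L"] by (auto simp: glue_def)

lemma plus_minus_split: "x \<in> plus_minus (set xs) \<longleftrightarrow> x \<in> plus_minus (set xs - L) \<or> x \<in> L \<or> - x \<in> L"
  using sub by (auto simp: plus_minus_def)

lemma plus_minus_disjoint: "x \<in> plus_minus (set xs - L) \<Longrightarrow> x \<notin> L \<and> - x \<notin> L"
proof (erule plus_minus_cases)
  assume "x \<in> set xs - L"
  moreover have "0 < - x" if "- x \<in> L" using that zero_freeD(5)[OF zero_free] sub(2) by blast
  ultimately show ?thesis using zero_freeD(5)[OF zero_free, of x] by auto
next
  assume "- x \<in> set xs - L"
  moreover have "0 < x" if "x \<in> L" using that zero_freeD(5)[OF zero_free] sub(2) by blast
  ultimately show ?thesis using zero_freeD(5)[OF zero_free, of "- x"] by auto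
qed

lemma glued_block:
  assumes "x \<in> plus_minus (set xs - L)" "B \<in> glued R" "x \<in> B"
  shows "\<exists>B'\<in>R. B = glue B' \<and> base x \<in> B'"
  using assms plus_minus_disjoint[OF assms(1)] by (auto simp: glued_def glue_def)

context
  fixes R
  assumes R: "zero_free (set ys) R"
begin

text \<open>Preimages under \<open>base\<close> of the blocks of a partition again form a partition.
  They are nonempty since \<open>base\<close> fixes survivors, and symmetry and the absence of
  zero-blocks carry over since \<open>base\<close> is odd.\<close>

lemma glued_zero_free: "zero_free (set xs) (glued R)"
proof (rule zero_freeI)
  show "\<Union>(glued R) = plus_minus (set xs)"
  proof (intro equalityI subsetI)
    fix x assume "x \<in> \<Union>(glued R)"
    then show "x \<in> plus_minus (set xs)" using plus_minus_split[of x]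
      by (auto simp: glued_def glue_def)
  next
    fix x assume x: "x \<in> plus_minus (set xs)"
    show "x \<in> \<Union>(glued R)"
    proof (cases "x \<in> plus_minus (set xs - L)")
      case True
      have "base x \<in> \<Union>R" using base_in[OF x] zero_freeD(1)[OF R] by simp
      then show ?thesis using True by (auto simp: glued_def glue_def)
    next
      case False
      then have "x \<in> L \<or> - x \<in> L" using x plus_minus_split by blast
      then show ?thesis by (force simp: glued_def)
    qed
  qed
  show "B = C" if BC: "B \<in> glued R" "C \<in> glued R" "x \<in> B" "x \<in> C" for B C x
  proof (cases "x \<in> plus_minus (set xs - L)")
    case True
    obtain B' where B': "B' \<in> R" "B = glue B'" "base x \<in> B'"
      using glued_block[OF True BC(1,3)] by blast
    obtain C' where C': "C' \<in> R" "C = glue C'" "base x \<in> C'"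
      using glued_block[OF True BC(2,4)] by blast
    have "B' = C'" using B'(1) C'(1) B'(3) C'(3) by (rule zero_freeD(2)[OF R])
    then show ?thesis using B'(2) C'(2) by simp
  next
    case False
    then have D: "D = {x}" if "D \<in> glued R" "x \<in> D" for D
      using that False by (auto simp: glued_def glue_def)
    show ?thesis using D[OF BC(1,3)] D[OF BC(2,4)] by simp
  qed
  show "{} \<notin> glued R"
  proof
    assume "{} \<in> glued R"
    then obtain B where B: "B \<in> R" "glue B = {}" by (auto simp: glued_def)
    then have "B = {}" using glue_inter[OF block_sub[OF R B(1)]] by simp
    then show False using zero_freeD(3)[OF R] B by simp
  qed
  show "uminus ` B \<in> glued R" if "B \<in> glued R" for B
  proof -
    consider B' where "B' \<in> R" "B = glue B'" | t where "t \<in> L" "B = {t} \<or> B = {- t}"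
      using \<open>B \<in> glued R\<close> by (auto simp: glued_def)
    then show ?thesis
    proof cases
      case 1
      have "x \<in> uminus ` glue B' \<longleftrightarrow> x \<in> glue (uminus ` B')" for x
        using base_uminus[of x] plus_minus_nonzero[of x] plus_minus_split[of x]
          by (auto simp: glue_def)
      then have "uminus ` B = glue (uminus ` B')" unfolding 1 by blast
      then show ?thesis using zero_freeD(4)[OF R 1(1)] by (auto simp: glued_def)
    next
      case 2
      then show ?thesis by (auto simp: glued_def)
    qed
  qed
  show False if B: "B \<in> glued R" "x \<in> B" "- x \<in> B" for B x
  proof -
    have x: "x \<in> plus_minus (set xs)" "x \<noteq> 0"
      using B \<open>\<Union>(glued R) = plus_minus (set xs)\<close> plus_minus_nonzero by blast+
    then obtain B' where B': "B' \<in> R" "B = glue B'" using B by (auto simp: glued_def)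
    then have "base x \<in> B'" "- base x \<in> B'" using B base_uminus[OF x(2)] by (auto simp: glue_def)
    then show False using zero_freeD(6)[OF R B'(1)] by blast
  qed
qed (rule zero_freeD(5)[OF zero_free])

text \<open>Makes the recursive premise of \<open>psi_rel.step\<close> available for a glued
  partition.\<close>

lemma restrict_blocks_glued: "restrict_blocks (glued R) (set ys) = R"
proof -
  have "glue B \<inter> plus_minus (set ys) = B" if "B \<in> R" for B
    using glue_inter[OF block_sub[OF R that]] .
  moreover have "t \<notin> plus_minus (set ys)" "- t \<notin> plus_minus (set ys)" if "t \<in> L" for t
    using plus_minus_disjoint[of t] that plus_minus_mono[of "set ys" "set xs - L"]
      plus_minus_uminus[of t] by auto
  ultimately have "(\<lambda>B. B \<inter> plus_minus (set ys)) ` glued R - {{}} = R - {{}}"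
    unfolding glued_def image_Un image_UN by (force simp: image_image)
  then show ?thesis using zero_freeD(3)[OF R] by (simp add: restrict_blocks_def)
qed

lemma same_block_glued:
  assumes "x \<in> plus_minus (set xs - L)" "y \<in> plus_minus (set xs - L)"
  shows "same_block (glued R) x y \<longleftrightarrow> same_block R (base x) (base y)"
proof
  assume "same_block (glued R) x y"
  then obtain B where "B \<in> R" "x \<in> glue B" "y \<in> glue B"
    unfolding same_block_def using glued_block[OF assms(1)] by blast
  then show "same_block R (base x) (base y)" by (auto simp: same_block_def glue_def)
next
  assume "same_block R (base x) (base y)"
  then obtain B where "B \<in> R" "base x \<in> B" "base y \<in> B" by (auto simp: same_block_def)
  then have "glue B \<in> glued R" "x \<in> glue B" "y \<in> glue B"
    using assms by (auto simp: glued_def glue_def)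
  then show "same_block (glued R) x y" unfolding same_block_def by blast
qed

lemma singleton_glued: "t \<in> L \<Longrightarrow> {t} \<in> glued R"
  by (auto simp: glued_def)

text \<open>The hypothesis is half of the swap equation one level down. A singleton \<open>t\<close>
  outside \<open>L\<close> would share its block with its base, hence be a survivor and a singleton
  of \<open>R\<close>, hence a left point among the survivors. Then \<open>kept_not_left\<close>
  puts a singleton of \<open>P\<close> right after \<open>t\<close>, and gluing adds it to the block
  of \<open>t\<close>.\<close>

lemma singleton_pairs_glued:
  assumes "singleton_pairs R \<subseteq> left_points ys (restrict_blocks P (set ys))"
  shows "singleton_pairs (glued R) = L"
proof (intro equalityI subsetI)
  fix t assume "t \<in> L"
  then show "t \<in> singleton_pairs (glued R)"
    using singleton_glued sub zero_freeD(5)[OF zero_free, of t] by (auto simp: singleton_iff)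
next
  fix t assume t: "t \<in> singleton_pairs (glued R)"
  have tx: "t \<in> set xs" using singleton_pairs_subset[OF glued_zero_free] t by auto
  show "t \<in> L"
  proof (rule ccontr)
    assume nL: "t \<notin> L"
    have tpm: "t \<in> plus_minus (set xs - L)" using tx nL by (simp add: plus_minus_def)
    have uniq: "y = t" if "same_block (glued R) t y" for y
      using same_block_singleton[OF glued_zero_free _ that] t by (simp add: singleton_iff)
    have bin: "base t \<in> plus_minus (set ys)" using base_in in_plus_minus tx by blast
    have "same_block R (base t) (base (base t))"
      using same_block_refl[OF R bin] plus_minus_base[OF bin] by simp
    moreover have "base t \<in> plus_minus (set xs - L)"
      using bin plus_minus_mono[of "set ys" "set xs - L"] by auto
    ultimately have bt: "base t = t" using uniq same_block_glued[OF tpm] by blast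
    have ty: "t \<in> set ys"
      using bt bin plus_minus_pos[of "set ys" t] zero_freeD(5)[OF zero_free] tx by auto
    obtain B where B: "B \<in> R" "{t} = glue B"
      using glued_block[OF tpm, of "{t}"] t by (auto simp: singleton_iff)
    have "B = {t}" using glue_inter[OF block_sub[OF R B(1)]] B(2) ty
      by (auto simp: plus_minus_def)
    then have "t \<in> singleton_pairs R" using B(1) t by (simp add: singleton_iff)
    then have "t \<in> left_points ys (restrict_blocks P (set ys))" using assms by auto
    then have "same_block P t (cyclic_next ys t)"
      by (simp add: left_points_def same_block_restrict_blocks)
    then have nS: "cyclic_next xs t \<in> S" using kept_not_left ty by blast
    have "base (cyclic_next xs t) = base t"
      using base_prev[OF cyclic_next_in[OF tx]] nS cyclic_next_rev_cyclic_next[OF dist tx] by simp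
    moreover have "cyclic_next xs t \<in> plus_minus (set xs - L)"
      using S_L_disjoint[OF nS] sub nS by (auto simp: plus_minus_def)
    ultimately have "same_block (glued R) t (cyclic_next xs t)"
      using same_block_glued[OF tpm] same_block_refl[OF R bin] by simp
    then have "cyclic_next xs t = t" by (rule uniq)
    then show False using nS ty by auto
  qed
qed

text \<open>Dual to the preceding lemma. If \<open>t\<close> outside \<open>S\<close> shared a block
  with its predecessor, neither would lie in \<open>L\<close>, so \<open>t\<close> would survive and
  be a right point of \<open>R\<close>. By hypothesis it is then a singleton after peeling, and
  \<open>new_singleton\<close> puts its predecessor into \<open>L\<close>.\<close>

lemma left_points_glued:
  assumes "left_points (rev ys) R \<subseteq> singleton_pairs (restrict_blocks P (set ys))"
  shows "left_points (rev xs) (glued R) = S"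
proof (intro equalityI subsetI)
  fix t assume t: "t \<in> S"
  then have tx: "t \<in> set xs" using sub by auto
  have "cyclic_next (rev xs) t \<in> plus_minus (set xs - L)" "t \<in> plus_minus (set xs - L)"
    using prev_S[OF t] S_L_disjoint[OF t] cyclic_next_in[of t "rev xs"] tx
      by (auto simp: plus_minus_def)
  moreover have "base (cyclic_next (rev xs) t) = base t" using base_prev[OF tx] t by simp
  ultimately have "same_block (glued R) t (cyclic_next (rev xs) t)"
    using same_block_glued same_block_refl[OF R base_in[OF in_plus_minus[OF tx]]] by simp
  then show "t \<in> left_points (rev xs) (glued R)" using tx by (simp add: left_points_def)
next
  fix t assume "t \<in> left_points (rev xs) (glued R)"
  then have tx: "t \<in> set xs" and same_block: "same_block (glued R) t (cyclic_next (rev xs) t)"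
    by (auto simp: left_points_def)
  show "t \<in> S"
  proof (rule ccontr)
    assume nS: "t \<notin> S"
    have px: "cyclic_next (rev xs) t \<in> set xs" using cyclic_next_in[of t "rev xs"] tx by simp
    have nL: "t \<notin> L"
      using same_block_singleton[OF glued_zero_free singleton_glued same_block] not_self(2)[of t]
        by auto
    have pL: "cyclic_next (rev xs) t \<notin> L"
      using same_block_singleton[OF glued_zero_free singleton_glued same_block_sym[OF same_block]]
        not_self(1)[of "cyclic_next (rev xs) t"]
        cyclic_next_cyclic_next_rev[OF dist tx] by auto
    have "same_block R (base t) (base (cyclic_next (rev xs) t))"
      using same_block_glued[of t "cyclic_next (rev xs) t"] same_block nL pL tx px
        by (simp add: plus_minus_def)
    then have "same_block R t (cyclic_next (rev ys) t)"
      using base_prev[OF tx] nS nL base_kept[of t] tx by simp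
    then have "t \<in> left_points (rev ys) R" using tx nS nL by (simp add: left_points_def)
    then have "{t} \<in> restrict_blocks P (set ys)" using assms by (auto simp: singleton_iff)
    then show False using new_singleton[of t] pL tx nS nL by simp
  qed
qed

end

end

subsection \<open>Existence of the corresponding partition\<close>

text \<open>This and \<open>one_pair\<close> are the partitions that one peeling step can empty; the
  branch \<open>R = {}\<close> of \<open>patch\<close> exchanges them. They coincide when
  \<open>T\<close> has one element.\<close>

definition all_singletons :: "int set \<Rightarrow> int set set" where
  "all_singletons T = (\<Union>t\<in>T. {{t}, {- t}})"

definition one_pair :: "int set \<Rightarrow> int set set" where
  "one_pair T = {T, uminus ` T}"

lemma zero_free_all_singletons: "\<forall>t\<in>T. 0 < t \<Longrightarrow> zero_free T (all_singletons T)"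
  by (rule zero_freeI) (auto simp: all_singletons_def plus_minus_def)

lemma zero_free_one_pair:
  assumes "\<forall>t\<in>T. 0 < t" "T \<noteq> {}"
  shows "zero_free T (one_pair T)"
proof (rule zero_freeI)
  have neg: "x \<notin> T \<or> - x \<notin> T" for x
    using assms(1)[rule_format, of x] assms(1)[rule_format, of "- x"] by linarith
  show "B = C" if "B \<in> one_pair T" "C \<in> one_pair T" "x \<in> B" "x \<in> C" for B C x
    using that neg[of x] by (auto simp: one_pair_def)
  show "uminus ` B \<in> one_pair T" if "B \<in> one_pair T" for B
    using that by (auto simp: one_pair_def image_image)
  show False if "B \<in> one_pair T" "x \<in> B" "- x \<in> B" for B x
    using that neg[of x] by (auto simp: one_pair_def)
qed (use assms in \<open>auto simp: one_pair_def plus_minus_def\<close>)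

lemma singleton_pairs_all_singletons:
  assumes "\<forall>t\<in>T. 0 < t"
  shows "singleton_pairs (all_singletons T) = T"
proof (intro equalityI subsetI)
  fix t assume "t \<in> singleton_pairs (all_singletons T)"
  then have "0 < t" "\<exists>u\<in>T. t = u \<or> t = - u" by (auto simp: singleton_iff all_singletons_def)
  then show "t \<in> T" using assms by fastforce
qed (use assms in \<open>auto simp: singleton_iff all_singletons_def\<close>)

text \<open>The right side is empty unless \<open>T\<close> has exactly one element, so the
  degenerate case needs no separate statement.\<close>

lemma singleton_pairs_one_pair:
  assumes "\<forall>t\<in>T. 0 < t"
  shows "singleton_pairs (one_pair T) = {t. T = {t}}"
proof (intro equalityI subsetI)
  fix t assume "t \<in> singleton_pairs (one_pair T)"
  then have t: "0 < t" "T = {t} \<or> uminus ` T = {t}" by (auto simp: singleton_iff one_pair_def)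
  have "uminus ` T \<noteq> {t}"
  proof
    assume "uminus ` T = {t}"
    then have "- t \<in> T" by (metis uminus_image_iff singletonI)
    then show False using assms t(1) by force
  qed
  then show "t \<in> {t. T = {t}}" using t by auto
qed (use assms in \<open>auto simp: singleton_iff one_pair_def\<close>)

lemma left_points_one_pair: "left_points xs (one_pair (set xs)) = set xs"
  using cyclic_next_in[of _ xs] by (auto simp: left_points_def same_block_def one_pair_def)

lemma left_points_all_singletons:
  assumes "distinct xs" "\<forall>t\<in>set xs. 0 < t"
  shows "left_points xs (all_singletons (set xs)) = {t. set xs = {t}}"
proof -
  have "same_block (all_singletons (set xs)) t (cyclic_next xs t) \<longleftrightarrow> cyclic_next xs t = t"
    if "t \<in> set xs" for t
    using that same_block_singleton[OF zero_free_all_singletons[OF assms(2)], of t "cyclic_next xs t"]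
    by (auto simp: same_block_def all_singletons_def)
  moreover have "cyclic_next xs t = t" if "set xs = {t}" for t using cyclic_next_in[of t xs] that
    by simp
  ultimately show ?thesis using cyclic_next_eq_self[OF assms(1)] by (auto simp: left_points_def)
qed

lemma eq_one_pair:
  assumes g: "zero_free T P" and "T \<in> P"
  shows "P = one_pair T"
proof (intro equalityI subsetI)
  fix B assume B: "B \<in> P"
  then obtain x where x: "x \<in> B" using zero_freeD(3)[OF g] by (metis ex_in_conv)
  have T': "uminus ` T \<in> P" using zero_freeD(4)[OF g assms(2)] .
  have "x \<in> plus_minus T" using block_sub[OF g B] x by auto
  then show "B \<in> one_pair T"
  proof (cases rule: plus_minus_cases)
    case 1
    then show ?thesis using zero_freeD(2)[OF g B assms(2) x] by (simp add: one_pair_def)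
  next
    case 2
    then show ?thesis using zero_freeD(2)[OF g B T' x] by (simp add: one_pair_def)
  qed
qed (use assms(2) zero_freeD(4)[OF g assms(2)] in \<open>auto simp: one_pair_def\<close>)

lemma singleton_uminus: "\<lbrakk>zero_free T P; {t} \<in> P\<rbrakk> \<Longrightarrow> {- t} \<in> P"
  using zero_freeD(4)[of T P "{t}"] by simp

lemma eq_all_singletons:
  assumes g: "zero_free T P" and T: "singleton_pairs P = T"
  shows "P = all_singletons T"
proof (intro equalityI subsetI)
  fix B assume B: "B \<in> P"
  then obtain x where x: "x \<in> B" using zero_freeD(3)[OF g] by (metis ex_in_conv)
  have "x \<in> plus_minus T" using block_sub[OF g B] x by auto
  then have "x \<in> T \<or> - x \<in> T" by (auto simp: plus_minus_def)
  moreover have "{x} \<in> P"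
    using calculation T singleton_uminus[OF g, of "- x"] by (auto simp: singleton_iff)
  then have "B = {x}" using zero_freeD(2)[OF g B _ x] by blast
  ultimately show "B \<in> all_singletons T" by (force simp: all_singletons_def)
next
  fix B assume "B \<in> all_singletons T"
  then show "B \<in> P" using T singleton_uminus[OF g]
    by (auto simp: all_singletons_def singleton_iff)
qed

text \<open>The successor of a left point is no isolated singleton unless it is that point itself,
  so if nothing survives, one left point makes all elements left points. They then lie in one block,
  which contains no negative element since it already contains all positive ones.\<close>

lemma all_removed:
  assumes dist: "distinct xs" and g: "zero_free (set xs) P"
    and none: "filter (\<lambda>t. t \<notin> singleton_pairs P \<and> t \<notin> left_points xs P) xs = []"
  shows "left_points xs P = set xs \<and> P = one_pair (set xs)
    \<or> left_points xs P = {} \<and> P = all_singletons (set xs)"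
proof (cases "left_points xs P = {}")
  case True
  then have "singleton_pairs P = set xs"
    using none singleton_pairs_subset[OF g] by (auto simp: filter_empty_conv)
  then show ?thesis using True eq_all_singletons[OF g] by simp
next
  case False
  then obtain t where t: "t \<in> left_points xs P" by blast
  then have tx: "t \<in> set xs" by (simp add: left_points_def)
  have all: "u \<in> left_points xs P" if "u \<in> set xs" for u
  proof -
    \<comment> \<open>Induction over the reversed list, because here the property passes from an
      element to its successor.\<close>
    have "distinct (rev xs)" "u \<in> set (rev xs)" "t \<in> set (rev xs)" using dist that tx by auto
    then show ?thesis
    proof (induction rule: cyclic_induct)
      case base
      then show ?case using t .
    next
      case (step v)
      show ?case
      proof (rule ccontr)
        assume v: "v \<notin> left_points xs P"
        then have "{v} \<in> P" using none step(1) by (auto simp: filter_empty_conv singleton_iff)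
        moreover have "same_block P (cyclic_next (rev xs) v) v"
          using step cyclic_next_cyclic_next_rev[OF dist, of v] by (auto simp: left_points_def)
        ultimately have "cyclic_next (rev xs) v = v"
          using same_block_singleton[OF g] same_block_sym by blast
        then show False using step v by simp
      qed
    qed
  qed
  have same_block: "same_block P u t" if "u \<in> set xs" for u
    using dist that tx
  proof (induction rule: cyclic_induct)
    case base
    then show ?case using same_block_refl[OF g] tx by (simp add: plus_minus_def)
  next
    case (step v)
    then have "same_block P v (cyclic_next xs v)" using all by (auto simp: left_points_def)
    then show ?case using step same_block_trans[OF g] by blast
  qed
  obtain B where B: "B \<in> P" "t \<in> B" using same_block[OF tx] by (auto simp: same_block_def)
  have sub: "set xs \<subseteq> B" using same_block same_block_in_block[OF g B] same_block_sym by blast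
  moreover have "B \<subseteq> set xs"
  proof
    fix x assume x: "x \<in> B"
    then have "x \<in> plus_minus (set xs)" using block_sub[OF g B(1)] by auto
    then show "x \<in> set xs" using zero_freeD(6)[OF g B(1) x] sub by (auto simp: plus_minus_def)
  qed
  ultimately have "set xs \<in> P" using B by auto
  then show ?thesis using all eq_one_pair[OF g] by (auto simp: left_points_def)
qed

lemma restrict_blocks_empty: "restrict_blocks P {} = {}"
  by (auto simp: restrict_blocks_def plus_minus_def)

lemma psi_rel_all_removed:
  assumes dist: "distinct xs" and g: "zero_free (set xs) P" "zero_free (set xs) Q" and "xs \<noteq> []"
    and eqs: "singleton_pairs P = left_points (rev xs) Q" "left_points xs P = singleton_pairs Q"
    and none: "filter (\<lambda>t. t \<notin> singleton_pairs P \<and> t \<notin> singleton_pairs Q) xs = []"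
  shows "psi_rel xs P Q"
proof (rule psi_rel.step[OF dist g eqs _ none[symmetric]])
  show "singleton_pairs P \<union> singleton_pairs Q \<noteq> {}"
    using none \<open>xs \<noteq> []\<close> by (cases xs) (auto split: if_splits)
  have "zero_free (set []) {}" by (rule zero_freeI) (auto simp: plus_minus_def)
  then show "psi_rel [] (restrict_blocks P (set [])) (restrict_blocks Q (set []))"
    using psi_rel.stop[of "[]" "{}"]
      by (simp add: restrict_blocks_empty left_points_def singleton_pairs_def)
qed

text \<open>Induction on the number of positive elements. The swap equations for the partner
  \<open>R\<close> of the peeled partition are exactly what the lemmas on \<open>glued R\<close> ask
  for; under total deletion the partner is the other of \<open>one_pair\<close> and
  \<open>all_singletons\<close>.\<close>

lemma psi_rel_exists: "\<lbrakk>distinct xs; zero_free (set xs) P\<rbrakk> \<Longrightarrow> \<exists>Q. psi_rel xs P Q"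
proof (induction "length xs" arbitrary: xs P rule: less_induct)
  case less
  note dist = less(2) and g = less(3)
  let ?ys = "filter (\<lambda>t. t \<notin> singleton_pairs P \<and> t \<notin> left_points xs P) xs"
  have pos: "\<forall>t\<in>set xs. 0 < t" using zero_freeD(5)[OF g] by blast
  consider "singleton_pairs P = {} \<and> left_points xs P = {}" | "xs \<noteq> []" "?ys = []"
    | "singleton_pairs P \<union> left_points xs P \<noteq> {}" "?ys \<noteq> []"
    by (cases "xs = []") (use singleton_pairs_subset[OF g] in \<open>auto simp: left_points_def\<close>)
  then show ?case
  proof cases
    case 1
    then show ?thesis using psi_rel.stop[OF dist g] by blast
  next
    case 2
    have drev: "distinct (rev xs)" "\<forall>t\<in>set (rev xs). 0 < t" using dist pos by auto
    have ne: "set xs \<noteq> {}" using 2 by simp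
    consider "left_points xs P = set xs" "P = one_pair (set xs)" | "left_points xs P = {}" "P
      = all_singletons (set xs)"
      using all_removed[OF dist g 2(2)] by blast
    then show ?thesis
    proof cases
      case 1
      have "psi_rel xs P (all_singletons (set xs))"
        by (rule psi_rel_all_removed[OF dist g zero_free_all_singletons[OF pos] 2(1)])
          (use 1 left_points_all_singletons[OF drev]
            pos in \<open>simp_all add: singleton_pairs_one_pair singleton_pairs_all_singletons\<close>)
      then show ?thesis by blast
    next
      case c: 2
      have "psi_rel xs P (one_pair (set xs))"
        by (rule psi_rel_all_removed[OF dist g zero_free_one_pair[OF pos ne] 2(1)])
          (use c left_points_all_singletons[OF dist pos] left_points_one_pair[of "rev xs"] pos in
            \<open>simp_all add: singleton_pairs_one_pair singleton_pairs_all_singletons\<close>)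
      then show ?thesis by blast
    qed
  next
    case 3
    interpret peeling xs P by unfold_locales (use dist g 3 in auto)
    obtain t where "t \<in> set xs" "\<not> kept t" using 3(1) sub(1,2) by blast
    then have "length ?ys < length xs" by (rule length_filter_less)
    then obtain R where R: "psi_rel ?ys (restrict_blocks P (set ?ys)) R"
      using less(1) zero_free_rest dist by (metis distinct_filter)
    note props = psi_rel_props[OF R]
    have L: "singleton_pairs (glued R) = L"
      using singleton_pairs_glued[OF props(3)] props(5) by simp
    have S: "left_points (rev xs) (glued R) = S"
      using left_points_glued[OF props(3)] props(4) by simp
    have "psi_rel xs P (glued R)"
    proof (rule psi_rel.step[OF dist g glued_zero_free[OF props(3)]])
      show "?ys = filter (\<lambda>t. t \<notin> singleton_pairs P \<and> t \<notin> singleton_pairs (glued R)) xs"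
        by (simp add: L)
      show "psi_rel ?ys (restrict_blocks P (set ?ys)) (restrict_blocks (glued R) (set ?ys))"
        using R by (simp only: restrict_blocks_glued[OF props(3)])
    qed (use L S 3 in auto)
    then show ?thesis by blast
  qed
qed

subsection \<open>Correctness of patching and peeling\<close>

lemma same_block_uminus:
  assumes g: "zero_free T P"
  shows "same_block P (- x) (- y) \<longleftrightarrow> same_block P x y"
proof -
  have "same_block P (- u) (- v)" if "same_block P u v" for u v
  proof -
    obtain B where B: "B \<in> P" "u \<in> B" "v \<in> B" using \<open>same_block P u v\<close>
      by (auto simp: same_block_def)
    then have "- u \<in> uminus ` B" "- v \<in> uminus ` B" by simp_all
    then show ?thesis using zero_freeD(4)[OF g B(1)] unfolding same_block_def by blast
  qed
  from this[of x y] this[of "- x" "- y"] show ?thesis by auto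
qed

section \<open>The index-based definitions in terms of lists\<close>

context
  fixes xs :: "int list" and P :: "int set set"
  assumes dist: "distinct xs" and sorted: "sorted xs" and zero_free: "zero_free (set xs) P"
begin

text \<open>Sortedness ties the list to \<open>pt\<close>; the relation \<open>psi_rel\<close>
  itself also makes sense for the reversed list.\<close>

lemma pt_nth: "pt P j = xs ! (j mod length xs)"
  using sorted dist positives_zero_free[OF zero_free]
  by (simp add: pt_def sorted_list_of_set_sort_remdups distinct_card sorted_sort_id distinct_remdups_id)

lemma card_positives: "card (positives P) = length xs"
  using positives_zero_free[OF zero_free] dist by (simp add: distinct_card)

lemma pt_in: "xs \<noteq> [] \<Longrightarrow> pt P j \<in> set xs"
  by (simp add: pt_nth)

lemma cyclic_next_pt: "xs \<noteq> [] \<Longrightarrow> cyclic_next xs (pt P j) = pt P (Suc j)"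
  using cyclic_next_nth[OF dist, of "j mod length xs"] by (simp add: pt_nth mod_Suc_eq)

lemma pt_obtain:
  assumes "t \<in> set xs"
  obtains k where "k < length xs" "t = pt P k"
  using assms by (auto simp: in_set_conv_nth pt_nth)

text \<open>An adjacency pair is determined by its left point, so counting pairs amounts to counting
  left points, also for two elements in one block.\<close>

lemma adjacency_pairs_left_points: "adjacency_pairs P
  = (\<lambda>t. (t, cyclic_next xs t)) ` left_points xs P"
proof (intro equalityI subsetI)
  fix z assume "z \<in> adjacency_pairs P"
  then obtain j where j: "z
    = (pt P j, pt P (Suc j))" "j < length xs" "same_block P (pt P j) (pt P (Suc j))"
    by (auto simp: adjacency_pairs_def card_positives same_block_def)
  then have "xs \<noteq> []" by auto
  then show "z \<in> (\<lambda>t. (t, cyclic_next xs t)) ` left_points xs P"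
    using j pt_in cyclic_next_pt by (auto simp: left_points_def)
next
  fix z assume "z \<in> (\<lambda>t. (t, cyclic_next xs t)) ` left_points xs P"
  then obtain t where t: "t \<in> set xs" "same_block P t (cyclic_next xs t)" "z
    = (t, cyclic_next xs t)"
    by (auto simp: left_points_def)
  then obtain k where k: "k < length xs" "t = pt P k" using pt_obtain by blast
  then have "cyclic_next xs t = pt P (Suc k)" using cyclic_next_pt[of k] by (cases xs) auto
  then show "z \<in> adjacency_pairs P"
    using t k unfolding adjacency_pairs_def card_positives same_block_def
    by (intro CollectI exI[of _ k]) simp
qed

lemma left_point_pairs_left_points: "left_point_pairs P = left_points xs P"
  by (simp add: left_point_pairs_def adjacency_pairs_left_points image_image)

lemma num_adjacency_pairs_left_points: "num_adjacency_pairs P = card (left_points xs P)"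
  unfolding num_adjacency_pairs_def adjacency_pairs_left_points by (intro card_image inj_onI) simp

lemma peel_restrict_blocks:
  "peel P = restrict_blocks P (set (filter (\<lambda>t. t \<notin> singleton_pairs P
    \<and> t \<notin> left_points xs P) xs))"
proof -
  let ?ys = "filter (\<lambda>t. t \<notin> singleton_pairs P \<and> t \<notin> left_points xs P) xs"
  have "B - {x. \<bar>x\<bar> \<in> singleton_pairs P
    \<union> left_points xs P} = B \<inter> plus_minus (set ?ys)" if B: "B \<in> P" for B
  proof -
    have "\<bar>x\<bar> \<notin> singleton_pairs P \<union> left_points xs P \<longleftrightarrow> x \<in> plus_minus (set ?ys)" if "x \<in> B" for x
    proof -
      have "x \<in> plus_minus (set xs)" using block_sub[OF zero_free B] that by auto
      then show ?thesis
      proof (cases rule: plus_minus_cases)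
        case 1
        then have "0 < x" using zero_freeD(5)[OF zero_free] by blast
        moreover have "- x \<notin> set xs" using zero_freeD(5)[OF zero_free, of "- x"] calculation
          by force
        ultimately show ?thesis using 1 by (auto simp: plus_minus_def)
      next
        case 2
        then have "0 < - x" using zero_freeD(5)[OF zero_free] by blast
        moreover have "x \<notin> set xs" using zero_freeD(5)[OF zero_free, of x] calculation by force
        ultimately show ?thesis using 2 by (auto simp: plus_minus_def)
      qed
    qed
    then show ?thesis by blast
  qed
  then show ?thesis unfolding peel_def restrict_blocks_def left_point_pairs_left_points by simp
qed

text \<open>The equations leave one choice for \<open>Q\<close>: if all elements are left points of
  \<open>P\<close>, all are singletons of \<open>Q\<close>; otherwise all are right points of
  \<open>Q\<close>, and \<open>all_removed\<close> for the reversed list identifies it.\<close>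

lemma patch_all_removed:
  assumes gQ: "zero_free (set xs) Q" and "xs \<noteq> []"
    and eqs: "singleton_pairs P = left_points (rev xs) Q" "left_points xs P = singleton_pairs Q"
    and none: "filter (\<lambda>t. t \<notin> singleton_pairs P \<and> t \<notin> singleton_pairs Q) xs = []"
  shows "patch P {} = Q"
proof -
  let ?T = "set xs"
  have pos: "\<forall>t\<in>?T. 0 < t" using zero_freeD(5)[OF zero_free] by blast
  have ne: "?T \<noteq> {}" using \<open>xs \<noteq> []\<close> by simp
  consider "left_points xs P = ?T" "P = one_pair ?T" | "left_points xs P = {}" "P
    = all_singletons ?T"
    using all_removed[OF dist zero_free] none eqs by auto
  then show ?thesis
  proof cases
    case 1
    have "\<exists>B. P = {B, uminus ` B}" using 1(2) by (auto simp: one_pair_def)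
    moreover have "Q = all_singletons ?T" using eq_all_singletons[OF gQ] 1 eqs by simp
    ultimately show ?thesis
      using positives_zero_free[OF zero_free] by (simp add: patch_def all_singletons_def)
  next
    case 2
    \<comment> \<open>If \<open>all_singletons\<close> passed the test in \<open>patch\<close>,
      there would be a single positive element, its own successor and hence a left point.\<close>
    have noone: "\<not> (\<exists>B. P = {B, uminus ` B})"
    proof
      assume "\<exists>B. P = {B, uminus ` B}"
      then obtain B where B: "P = {B, uminus ` B}" by blast
      obtain t where t: "t \<in> ?T" using ne ex_in_conv by metis
      have tP: "{t} \<in> P" using 2 t by (auto simp: all_singletons_def)
      have "B = {t} \<or> B = {- t}"
      proof -
        have "B = {t} \<or> uminus ` B = {t}" using tP B by blast
        moreover have "B = {- t}" if "uminus ` B = {t}"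
        proof -
          have "B = uminus ` uminus ` B" by (simp add: image_image)
          then show ?thesis using that by simp
        qed
        ultimately show ?thesis by blast
      qed
      then have "\<Union>P = {t, - t}" unfolding B by auto
      then have "?T \<subseteq> {t, - t}" using zero_freeD(1)[OF zero_free] by (auto simp: plus_minus_def)
      moreover have "- t \<notin> ?T"
        using pos[rule_format, OF t] pos[rule_format, of "- t"] by linarith
      ultimately have "?T = {t}" using t by auto
      then have "cyclic_next xs t = t" using cyclic_next_in[OF t] by simp
      then have "t \<in> left_points xs P" using t tP by (auto simp: left_points_def same_block_def)
      then show False using 2 by simp
    qed
    have "singleton_pairs P = ?T" using 2 singleton_pairs_all_singletons[OF pos] by simp
    then have "left_points (rev xs) Q = ?T" using eqs by simp
    moreover have "singleton_pairs Q = {}" using eqs 2 by simp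
    moreover have "filter (\<lambda>t. t \<notin> singleton_pairs Q \<and> t \<notin> left_points (rev xs) Q) (rev xs) = []"
      using calculation by (simp add: filter_empty_conv)
    moreover have "distinct (rev xs)" "zero_free (set (rev xs)) Q" using dist gQ by auto
    ultimately have "Q = one_pair ?T" using all_removed[of "rev xs" Q] ne by auto
    then show ?thesis
      using noone positives_zero_free[OF zero_free] by (simp add: patch_def one_pair_def)
  qed
qed

lemma singleton_run_exists:
  assumes t: "t \<in> singleton_pairs P" and u: "u \<in> set xs" "u \<notin> singleton_pairs P"
  shows "\<exists>j h m. singleton_run P j h \<and> m \<in> {1..h} \<and> t = pt P (j + m)"
proof -
  let ?r = "length xs" and ?s = "\<lambda>i. pt P i \<in> singleton_pairs P"
  have r: "0 < ?r" using u by (cases xs) auto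
  have per: "pt P (i + ?r) = pt P i" for i by (simp add: pt_nth)
  obtain i0 where i0: "i0 < ?r" "\<not> ?s i0" using u pt_obtain by metis
  obtain k where k: "k < ?r" "t = pt P k"
    using t singleton_pairs_subset[OF zero_free] pt_obtain by blast
  \<comment> \<open>The position of \<open>t\<close> is read as \<open>k + ?r\<close> instead of
    \<open>k\<close>, so that the non-singleton index \<open>i0 < ?r\<close> is certain to precede
    it.\<close>
  define A where "A = {i. i \<le> k + ?r \<and> \<not> ?s i}"
  have "finite A" unfolding A_def by simp
  moreover have "i0 \<in> A" using i0 by (simp add: A_def)
  ultimately have Max: "Max A \<in> A" "\<And>i. i \<in> A \<Longrightarrow> i \<le> Max A" by (auto intro: Max_in)
  define a where "a = Max A"
  have sk: "?s (k + ?r)" using t k per by simp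
  have a: "\<not> ?s a" "a \<le> k + ?r" using Max(1) by (auto simp: A_def a_def)
  then have ak: "a < k + ?r" using sk by (metis le_neq_implies_less)
  have before: "?s i" if "a < i" "i \<le> k + ?r" for i
  proof (rule ccontr)
    assume "\<not> ?s i"
    then have "i \<in> A" using that by (simp add: A_def)
    then show False using Max(2)[of i] that by (simp add: a_def)
  qed
  \<comment> \<open>Two periods guarantee an index beyond \<open>k + ?r\<close>, as
    \<open>k < ?r\<close>.\<close>
  have "\<not> ?s (i0 + ?r + ?r)" using i0 per by simp
  then have ex: "\<exists>n. k + ?r < n \<and> \<not> ?s n" using i0 k by (intro exI[of _ "i0 + ?r + ?r"]) simp
  define n where "n = (LEAST n. k + ?r < n \<and> \<not> ?s n)"
  have n: "k + ?r < n" "\<not> ?s n" using LeastI_ex[OF ex] by (auto simp: n_def)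
  have after: "?s i" if "k + ?r < i" "i < n" for i
    using not_less_Least[of i "\<lambda>n. k + ?r < n \<and> \<not> ?s n"] that by (auto simp: n_def)
  define h where "h = n - a - 1"
  \<comment> \<open>\<open>singleton_run\<close> demands a start below \<open>?r\<close>, while
    \<open>a\<close> may exceed it.\<close>
  have shift: "pt P (a mod ?r + i) = pt P (a + i)" for i by (simp add: pt_nth mod_add_left_eq)
  have "singleton_run P (a mod ?r) h"
    unfolding singleton_run_def card_positives add.assoc shift
  proof (intro conjI ballI)
    show "a mod ?r < ?r" using r by simp
    show "1 \<le> h" using n ak by (simp add: h_def)
    show "pt P (a mod ?r) \<notin> singleton_pairs P" using a shift[of 0] by simp
    show "pt P (a + m) \<in> singleton_pairs P" if "m \<in> {1..h}" for m
      using that before[of "a + m"] after[of "a + m"]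
        by (cases "a + m \<le> k + ?r") (auto simp: h_def)
    have "a + (h + 1) = n" using n ak by (simp add: h_def)
    then show "pt P (a + (h + 1)) \<notin> singleton_pairs P" using n by simp
  qed
  moreover have "k + ?r - a \<in> {1..h}" using n ak by (auto simp: h_def)
  moreover have "t = pt P (a mod ?r + (k + ?r - a))" unfolding shift using ak k per by simp
  ultimately show ?thesis by blast
qed

text \<open>The swap equations force the shape of \<open>Q\<close>: singletons of \<open>P\<close>
  are right points of \<open>Q\<close>, so each run lies in the block of the element before it, and
  left points of \<open>P\<close> are singletons of \<open>Q\<close>. Hence each block is either
  such a singleton or its trace on the survivors together with the attached runs.\<close>

lemma patch_rest:
  assumes gQ: "zero_free (set xs) Q"
    and eqs: "singleton_pairs P = left_points (rev xs) Q" "left_points xs P = singleton_pairs Q"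
    and ys: "ys = filter (\<lambda>t. t \<notin> singleton_pairs P \<and> t \<notin> singleton_pairs Q) xs" "ys \<noteq> []"
  shows "patch P (restrict_blocks Q (set ys)) = Q"
proof -
  interpret peeling xs P by unfold_locales (use dist zero_free ys eqs in auto)
  let ?R = "restrict_blocks Q (set ys)"
  have ne: "xs \<noteq> []" using ys by auto
  have run_same: "same_block Q (pt P j) (pt P (j + m))" if "singleton_run P j h" "m \<le> h" for j h m
    using that(2)
  proof (induction m)
    case 0
    then show ?case using same_block_refl[OF gQ in_plus_minus[OF pt_in[OF ne]]] by simp
  next
    case (Suc m)
    have "\<forall>i\<in>{1..h}. pt P (j + i) \<in> singleton_pairs P" using that(1)
      by (simp add: singleton_run_def)
    moreover have "Suc m \<in> {1..h}" using Suc.prems by simp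
    ultimately have "pt P (j + Suc m) \<in> singleton_pairs P" by blast
    then have "same_block Q (pt P (j + Suc m)) (cyclic_next (rev xs) (pt P (j + Suc m)))"
      using eqs by (simp add: left_points_def)
    moreover have "cyclic_next (rev xs) (pt P (j + Suc m)) = pt P (j + m)"
      using cyclic_next_rev_cyclic_next[OF dist pt_in[OF ne], of "j + m"] cyclic_next_pt[OF ne]
        by simp
    ultimately show ?case using Suc same_block_sym same_block_trans[OF gQ] by (metis Suc_leD)
  qed
  \<comment> \<open>The element before a run is no left point, since left points are not followed by
    singletons; so it survives.\<close>
  have run_start: "pt P j \<in> set ys" if "singleton_run P j h" for j h
  proof -
    have "pt P (Suc j) \<in> singleton_pairs P" "pt P j \<notin> singleton_pairs P"
      using that by (auto simp: singleton_run_def dest: bspec[of _ _ 1])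
    moreover have "pt P j \<notin> left_points xs P"
      using calculation cyclic_next_L cyclic_next_pt[OF ne] by metis
    ultimately show ?thesis using pt_in[OF ne] ys eqs by simp
  qed
  have reach: "\<exists>j h m. singleton_run P j h \<and> m \<in> {1..h} \<and> t = pt P (j + m)" if "t \<in> S" for t
    using singleton_run_exists[OF that, of "hd ys"] hd_in_set[OF ys(2)] ys(1) by auto
  have enlarge: "enlarge_block P (B \<inter> plus_minus (set ys)) = B"
    if B: "B \<in> Q" and BI: "B \<inter> plus_minus (set ys) \<noteq> {}" for B
  proof (intro equalityI subsetI)
    fix x assume "x \<in> enlarge_block P (B \<inter> plus_minus (set ys))"
    then consider "x \<in> B"
      | j h m where "singleton_run P j h" "pt P j \<in> B" "m \<in> {1..h}" "x = pt P (j + m)"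
      | j h m where "singleton_run P j h" "- pt P j \<in> B" "m \<in> {1..h}" "x = - pt P (j + m)"
      by (auto simp: enlarge_block_def)
    then show "x \<in> B"
    proof cases
      case 2
      then show ?thesis using run_same[of j h m] same_block_in_block[OF gQ B] by auto
    next
      case 3
      then have "same_block Q (- pt P j) x" using run_same[of j h m] same_block_uminus[OF gQ]
        by auto
      then show ?thesis using 3 same_block_in_block[OF gQ B] by blast
    qed
  next
    fix x assume x: "x \<in> B"
    have notsing: "{x} \<notin> Q"
    proof
      assume "{x} \<in> Q"
      then have Bx: "B = {x}" using zero_freeD(2)[OF gQ B _ x] by blast
      then have "x \<in> plus_minus (set ys)" using BI by auto
      then show False
      proof (cases rule: plus_minus_cases)
        case 1
        then show ?thesis using \<open>{x} \<in> Q\<close> zero_freeD(5)[OF zero_free, of x] ys(1)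
          by (auto simp: singleton_iff)
      next
        case 2
        then show ?thesis
          using singleton_uminus[OF gQ \<open>{x} \<in> Q\<close>] zero_freeD(5)[OF zero_free, of "- x"] ys(1)
          by (auto simp: singleton_iff)
      qed
    qed
    have notsing': "{- x} \<notin> Q" using notsing singleton_uminus[OF gQ, of "- x"] by auto
    have "x \<in> plus_minus (set xs)" using block_sub[OF gQ B] x by auto
    then consider "x \<in> plus_minus (set ys)" | "x \<in> S" | "- x \<in> S"
      using notsing notsing' ys(1) by (auto simp: plus_minus_def singleton_iff)
    then show "x \<in> enlarge_block P (B \<inter> plus_minus (set ys))"
    proof cases
      case 1
      then show ?thesis using x by (simp add: enlarge_block_def)
    next
      case 2
      then obtain j h m where r: "singleton_run P j h" "m \<in> {1..h}" "x = pt P (j + m)"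
        using reach by blast
      have "pt P j \<in> B"
        using run_same[OF r(1), of m] r same_block_sym same_block_in_block[OF gQ B x] by auto
      then have "pt P j \<in> B \<inter> plus_minus (set ys)" using run_start[OF r(1)]
        by (simp add: plus_minus_def)
      then show ?thesis using r unfolding enlarge_block_def by blast
    next
      case 3
      then obtain j h m where r: "singleton_run P j h" "m \<in> {1..h}" "- x = pt P (j + m)"
        using reach by blast
      have "same_block Q (- x) (pt P j)" using run_same[OF r(1), of m] r same_block_sym by auto
      then have "same_block Q x (- pt P j)" using same_block_uminus[OF gQ, of x "- pt P j"]
        by simp
      then have "- pt P j \<in> B" using same_block_in_block[OF gQ B x] by blast
      then have "- pt P j \<in> B \<inter> plus_minus (set ys)" using run_start[OF r(1)]
        by (simp add: plus_minus_def)
      moreover have "x = - pt P (j + m)" using r(3) by simp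
      ultimately show ?thesis using r(1,2) unfolding enlarge_block_def by blast
    qed
  qed
  \<comment> \<open>A block without survivors contains no run element, because a run starts at a
    survivor of its own block; only the elements of \<open>L\<close> and their negatives
    remain.\<close>
  have rest_cases: "B \<inter> plus_minus (set ys) \<noteq> {} \<or> B \<in> (\<Union>t\<in>L. {{t}, {- t}})" if B: "B \<in> Q" for B
  proof (rule ccontr)
    assume neg: "\<not> ?thesis"
    obtain x where x: "x \<in> B" using zero_freeD(3)[OF gQ] B by (metis ex_in_conv)
    have nb: "\<not> same_block Q x z" if "z \<in> plus_minus (set ys)" for z
      using neg same_block_in_block[OF gQ B x] that by blast
    have "x \<in> plus_minus (set xs)" "x \<notin> plus_minus (set ys)" using block_sub[OF gQ B] x neg
      by auto
    then consider "x \<in> L" | "- x \<in> L" | "x \<in> S" | "- x \<in> S"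
      using ys(1) eqs(2) by (auto simp: plus_minus_def)
    then show False
    proof cases
      case 1
      then have "{x} \<in> Q" using eqs by (simp add: singleton_iff)
      then have "B = {x}" using zero_freeD(2)[OF gQ B _ x] by blast
      then show False using 1 neg by auto
    next
      case 2
      then have "{x} \<in> Q" using eqs singleton_uminus[OF gQ, of "- x"] by (simp add: singleton_iff)
      then have "B = {x}" using zero_freeD(2)[OF gQ B _ x] by blast
      then have "B \<in> {{- x}, {- (- x)}}" by simp
      then show False using 2 neg by blast
    next
      case 3
      then obtain j h m where r: "singleton_run P j h" "m \<in> {1..h}" "x = pt P (j + m)"
        using reach by blast
      then have "same_block Q x (pt P j)" using run_same[OF r(1), of m] same_block_sym by auto
      then show False using nb[of "pt P j"] run_start[OF r(1)] by (simp add: plus_minus_def)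
    next
      case 4
      then obtain j h m where r: "singleton_run P j h" "m \<in> {1..h}" "- x = pt P (j + m)"
        using reach by blast
      then have "same_block Q (- x) (pt P j)" using run_same[OF r(1), of m] same_block_sym by auto
      then have "same_block Q x (- pt P j)" using same_block_uminus[OF gQ, of x "- pt P j"]
        by simp
      then show False using nb[of "- pt P j"] run_start[OF r(1)] by (simp add: plus_minus_def)
    qed
  qed
  have "set ys \<subseteq> set xs" using ys(1) by auto
  moreover have "set ys \<noteq> {}" using ys(2) by simp
  ultimately have Rne: "?R \<noteq> {}" using zero_free_empty_iff[OF zero_free_restrict_blocks[OF gQ]]
    by blast
  have "enlarge_block P ` ?R \<union> (\<Union>t\<in>L. {{t}, {- t}}) = Q"
  proof (intro equalityI subsetI)
    fix B assume "B \<in> enlarge_block P ` ?R \<union> (\<Union>t\<in>L. {{t}, {- t}})"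
    then consider C where "C \<in> ?R" "B = enlarge_block P C" | t where "t \<in> L" "B = {t} \<or> B = {- t}"
      by auto
    then show "B \<in> Q"
    proof cases
      case 1
      then obtain D where "D \<in> Q" "C = D \<inter> plus_minus (set ys)" "C \<noteq> {}"
        by (auto simp: restrict_blocks_def)
      then show ?thesis using enlarge[of D] 1 by simp
    next
      case 2
      then show ?thesis using eqs(2) singleton_uminus[OF gQ, of t] by (auto simp: singleton_iff)
    qed
  next
    fix B assume B: "B \<in> Q"
    show "B \<in> enlarge_block P ` ?R \<union> (\<Union>t\<in>L. {{t}, {- t}})"
    proof (cases "B \<inter> plus_minus (set ys) = {}")
      case True
      then show ?thesis using rest_cases[OF B] by blast
    next
      case False
      then have "B \<inter> plus_minus (set ys) \<in> ?R" using B by (auto simp: restrict_blocks_def)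
      then have "enlarge_block P (B \<inter> plus_minus (set ys)) \<in> enlarge_block P ` ?R"
        by (rule imageI)
      then show ?thesis using enlarge[OF B False] by simp
    qed
  qed
  then show ?thesis using Rne by (simp add: patch_def left_point_pairs_left_points)
qed

end

section \<open>Unfolding \<open>psi\<close> one peeling step at a time\<close>

definition no_pairs :: "int set set \<Rightarrow> bool" where
  "no_pairs P \<longleftrightarrow> singleton_pairs P = {} \<and> adjacency_pairs P = {}"

lemma psi_stop: "no_pairs P \<Longrightarrow> psi P = P"
proof -
  assume "no_pairs P"
  then have "peel_length P = 0"
    unfolding peel_length_def by (intro Least_eq_0) (simp add: peeled_def no_pairs_def)
  then show ?thesis by (simp add: psi_def peeled_def)
qed

lemma peeled_Suc: "peeled P (Suc k) = peeled (peel P) k"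
  by (simp add: peeled_def funpow_swap1)

text \<open>The second assumption says that peeling stops, so that the \<open>LEAST\<close> in
  \<open>peel_length\<close> is attained and shifts by exactly one.\<close>

lemma psi_step:
  assumes "\<not> no_pairs P" "no_pairs (peeled (peel P) k)"
  shows "psi P = patch P (psi (peel P))"
proof -
  have "peel_length P = (LEAST k. no_pairs (peeled P k))" for P
    by (simp add: peel_length_def no_pairs_def)
  moreover have "(LEAST k. no_pairs (peeled P k)) = Suc (LEAST k. no_pairs (peeled P (Suc k)))"
    using assms by (intro Least_Suc[of _ "Suc k"])
      (simp_all add: peeled_Suc, simp add: peeled_def)
  ultimately have len: "peel_length P = Suc (peel_length (peel P))" by (simp add: peeled_Suc)
  have "map (peeled P) [0..<Suc m] = P # map (peeled (peel P)) [0..<m]" for m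
    unfolding upt_conv_Cons[OF zero_less_Suc] map_Suc_upt[symmetric]
    by (simp add: peeled_Suc o_def) (simp add: peeled_def)
  then show ?thesis unfolding psi_def len peeled_Suc by simp
qed

text \<open>Termination of peeling is carried in the conclusion because \<open>psi_step\<close> asks
  for it one level down; the finite derivation of \<open>psi_rel\<close> supplies it.\<close>

lemma psi_rel_psi: "\<lbrakk>psi_rel xs P Q; sorted xs\<rbrakk> \<Longrightarrow> psi P = Q \<and> (\<exists>k. no_pairs (peeled P k))"
proof (induction rule: psi_rel.induct)
  case (stop xs P)
  then have "no_pairs P" by (simp add: no_pairs_def adjacency_pairs_left_points)
  moreover have "peeled P 0 = P" by (simp add: peeled_def)
  ultimately show ?case using psi_stop by metis
next
  case (step xs P Q ys)
  note d = step(1) and g = step(2) and s = step(10)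
  have "sorted ys" using s step(7) by (simp add: sorted_wrt_filter)
  then have IH: "psi (restrict_blocks P (set ys))
    = restrict_blocks Q (set ys)" "\<exists>k. no_pairs (peeled (restrict_blocks P (set ys)) k)"
    using step by auto
  have peel: "peel P = restrict_blocks P (set ys)" using peel_restrict_blocks[OF d s g] step(5,7)
    by simp
  then obtain k where k: "no_pairs (peeled (peel P) k)" using IH by auto
  have "\<not> no_pairs P" using step(5,6) adjacency_pairs_left_points[OF d s g]
    by (auto simp: no_pairs_def)
  then have "psi P = patch P (restrict_blocks Q (set ys))" using psi_step[OF _ k] IH peel by simp
  also have "\<dots> = Q"
  proof (cases "ys = []")
    case True
    have "xs \<noteq> []" using step(6) singleton_pairs_subset[OF g] singleton_pairs_subset[OF step(3)]
      by auto
    then show ?thesis using patch_all_removed[OF d s g step(3) _ step(4,5)] step(7) True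
      by (simp add: restrict_blocks_empty)
  next
    case False
    then show ?thesis using patch_rest[OF d s g step(3-5) step(7)] by simp
  qed
  finally show ?case using k peeled_Suc by metis
qed

section \<open>The complement and the conclusion\<close>

lemma V_iff_zero_free: "P \<in> V n \<longleftrightarrow> zero_free {1..int n} P"
  by (auto simp: V_def type_B_partition_def zero_block_def zero_free_def
    plus_minus_def pm_interval_def)

lemma omega_partition_map_blocks: "omega_partition n P = map_blocks (omega n) P"
  by (simp add: omega_partition_def map_blocks_def)

lemma odd_inj_omega: "odd_inj {1..int n} (omega n)"
  unfolding odd_inj_def
proof (intro conjI)
  show "inj_on (omega n) (plus_minus {1..int n})"
    by (rule inj_onI) (auto simp: plus_minus_def omega_def split: if_splits)
qed (auto simp: plus_minus_def omega_def)

lemma omega_omega: "x \<in> plus_minus {1..int n} \<Longrightarrow> omega n (omega n x) = x"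
  by (auto simp: plus_minus_def omega_def)

lemma omega_partition_invol:
  assumes g: "zero_free {1..int n} P"
  shows "omega_partition n (omega_partition n P) = P"
proof -
  have "(\<lambda>x. omega n (omega n x)) ` B = B" if "B \<in> P" for B
  proof -
    have "(\<lambda>x. omega n (omega n x)) ` B = (\<lambda>x. x) ` B"
      by (rule image_cong) (use omega_omega block_sub[OF g that] in auto)
    then show ?thesis by simp
  qed
  then show ?thesis by (simp add: omega_partition_def image_image)
qed

text \<open>Brings the reversed relation back to the increasing list, the setting in which it
  describes \<open>psi\<close>.\<close>

lemma map_omega_rev: "map (omega n) (rev [1..int n]) = [1..int n]"
proof (rule nth_equalityI)
  fix i assume "i < length (map (omega n) (rev [1..int n]))"
  then have "i < n" by simp
  then show "map (omega n) (rev [1..int n]) ! i = [1..int n] ! i"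
    by (simp add: rev_nth nth_upto omega_def of_nat_diff)
qed simp

theorem theorem3p1:
  fixes n :: nat
  assumes "n \<ge> 1"
  shows "(\<forall>\<pi>\<in>V n. omega_partition n (psi \<pi>) \<in> V n)
    \<and> (\<forall>\<pi>\<in>V n. omega_partition n (psi (omega_partition n (psi \<pi>))) = \<pi>)
    \<and> (\<forall>\<pi>\<in>V n.
          num_singleton_pairs (omega_partition n (psi \<pi>)) = num_adjacency_pairs \<pi>
        \<and> num_adjacency_pairs (omega_partition n (psi \<pi>)) = num_singleton_pairs \<pi>)"
proof -
  let ?xs = "[1..int n]" and ?w = "omega n"
  have xs: "distinct ?xs" "sorted ?xs" "set ?xs = {1..int n}" by simp_all
  have inj: "inj_on ?w {1..int n}" using odd_inj_omega
    by (auto simp: odd_inj_def plus_minus_def inj_on_Un)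
  have "omega_partition n (psi P) \<in> V n
      \<and> omega_partition n (psi (omega_partition n (psi P))) = P
      \<and> num_singleton_pairs (omega_partition n (psi P)) = num_adjacency_pairs P
      \<and> num_adjacency_pairs (omega_partition n (psi P)) = num_singleton_pairs P"
    if "P \<in> V n" for P
  proof -
    have g: "zero_free (set ?xs) P" using that by (simp add: V_iff_zero_free)
    obtain Q where Q: "psi_rel ?xs P Q" using psi_rel_exists[OF xs(1) g] by blast
    have psiP: "psi P = Q" using psi_rel_psi[OF Q xs(2)] by simp
    have "psi_rel (map ?w (rev ?xs)) (map_blocks ?w Q) (map_blocks ?w P)"
      using psi_rel_map_blocks[OF psi_rel_rev[OF Q]] odd_inj_omega by simp
    then have Q': "psi_rel ?xs (map_blocks ?w Q) (map_blocks ?w P)" by (simp only: map_omega_rev)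
    note props = psi_rel_props[OF Q] and props' = psi_rel_props[OF Q']
    have card_image_w: "card (?w ` A) = card A" if "A \<subseteq> {1..int n}" for A
      using card_image[OF inj_on_subset[OF inj that]] .
    have sing: "singleton_pairs (map_blocks ?w R) = ?w ` singleton_pairs R"
      "singleton_pairs R \<subseteq> {1..int n}" if "zero_free (set ?xs) R" for R
      using singleton_pairs_map_blocks[of "{1..int n}" R, OF _ odd_inj_omega]
        singleton_pairs_subset[OF that] that by auto
    have "num_singleton_pairs (map_blocks ?w Q) = num_adjacency_pairs P"
      using card_image_w sing[OF props(3)] props(5) num_adjacency_pairs_left_points[OF xs(1,2) g]
      by (simp add: num_singleton_pairs_def)
    \<comment> \<open>The swap equation is used here for the complemented pair, where
      \<open>omega\<close> applied to \<open>P\<close> is the partner.\<close>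
    moreover have "num_adjacency_pairs (map_blocks ?w Q) = num_singleton_pairs P"
      using card_image_w sing[OF g]
        props'(5) num_adjacency_pairs_left_points[OF xs(1,2) props'(2)]
      by (simp add: num_singleton_pairs_def)
    moreover have "psi (map_blocks ?w Q) = map_blocks ?w P" using psi_rel_psi[OF Q' xs(2)] by simp
    moreover have "map_blocks ?w (map_blocks ?w P) = P"
      using omega_partition_invol[of n P] g by (simp add: omega_partition_map_blocks)
    ultimately show ?thesis using props'(2)
      by (simp add: psiP omega_partition_map_blocks V_iff_zero_free)
  qed
  then show ?thesis by blast
qed

end
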